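(* Let $\mathfrak g$ be a finite dimensional complex Lie algebra, $\mathfrak h\subset\mathfrak g$ an abelian subalgebra, and $J:\mathfrak h^*\to(U\mathfrak g\otimes U\mathfrak g)^{\mathfrak h}[[\hbar]]$ a quantum dynamical twist. Assume there is a Lie subalgebra $\mathfrak v\subset\mathfrak g$ such that $\mathfrak g=\mathfrak h\oplus\mathfrak v$ as a vector space (so that $U\mathfrak g=U\mathfrak v\oplus U\mathfrak g\cdot\mathfrak h$). Let $J_{\mathfrak v}(\lambda)$ be the image of $J(\lambda)$ under the projection onto $(U\mathfrak v\otimes U\mathfrak v)[[\hbar]]$ along $\big((U\mathfrak g\cdot\mathfrak h)\otimes U\mathfrak g+U\mathfrak g\otimes(U\mathfrak g\cdot\mathfrak h)\big)[[\hbar]]$. Then for every $\lambda\in\mathrm{Dom}\,J$ the element $J_{\mathfrak v}(\lambda)$ is a quantum twist for $U\mathfrak v$, i.e. $$J_{\mathfrak v}(\lambda)^{12,3}J_{\mathfrak v}(\lambda)^{12}=J_{\mathfrak v}(\lambda)^{1,23}J_{\mathfrak v}(\lambda)^{23},\qquad(\varepsilon\otimes\mathrm{id})(J_{\mathfrak v}(\lambda))=(\mathrm{id}\otimes\varepsilon)(J_{\mathfrak v}(\lambda))=1.$$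
   Context: Universal enveloping algebras carry their standard Hopf algebra structure with comultiplication $\Delta$ and counit $\varepsilon$. A quantum dynamical twist is a meromorphic function $J:\mathfrak h^*\to(U\mathfrak g\otimes U\mathfrak g)^{\mathfrak h}[[\hbar]]$ such that $$J(\lambda)^{12,3}\,J(\lambda-\hbar h^{(3)})^{12}=J(\lambda)^{1,23}\,J(\lambda)^{23},\qquad (\varepsilon\otimes\mathrm{id})(J(\lambda))=(\mathrm{id}\otimes\varepsilon)(J(\lambda))=1.$$ Here $A^{12,3}=(\Delta\otimes\mathrm{id})(A)$, $A^{1,23}=(\mathrm{id}\otimes\Delta)(A)$, $A^{12}=A\otimes1$, $A^{23}=1\otimes A$, and $$J(\lambda-\hbar h^{(3)})^{12}=J(\lambda)\otimes1-\hbar\sum_i\frac{\partial J}{\partial\lambda_i}(\lambda)\otimes h_i+\frac{\hbar^2}2\sum_{i,j}\frac{\partial^2J}{\partial\lambda_i\partial\lambda_j}(\lambda)\otimes h_ih_j-\dots,$$ with $(h_i)$ a basis of $\mathfrak h$ and $(\lambda_i)$ the corresponding coordinates on $\mathfrak h^*$. $\mathrm{Dom}\,J$ is the set of points where $J$ is defined. *)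

theory Defs
  imports "HOL-Analysis.Analysis" "HOL-Library.Poly_Mapping"
begin

section \<open>Complex vector spaces and algebras\<close>

class complex_vector = ab_group_add +
  fixes scaleC :: "complex \<Rightarrow> 'a \<Rightarrow> 'a" (infixr \<open>*\<^sub>C\<close> 75)
  assumes scaleC_add_right: "a *\<^sub>C (x + y) = a *\<^sub>C x + a *\<^sub>C y"
    and scaleC_add_left: "(a + b) *\<^sub>C x = a *\<^sub>C x + b *\<^sub>C x"
    and scaleC_scaleC: "a *\<^sub>C b *\<^sub>C x = (a * b) *\<^sub>C x"
    and scaleC_one: "1 *\<^sub>C x = x"

class complex_algebra_1 = complex_vector + ring_1 +
  assumes mult_scaleC_left: "(c *\<^sub>C x) * y = c *\<^sub>C (x * y)"
    and mult_scaleC_right: "x * (c *\<^sub>C y) = c *\<^sub>C (x * y)"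

interpretation cvec: vector_space "scaleC :: complex \<Rightarrow> 'a \<Rightarrow> 'a::complex_vector"
  by standard (simp_all add: scaleC_add_right scaleC_add_left scaleC_scaleC scaleC_one)

interpretation cvec_pair: vector_space_pair
  "scaleC :: complex \<Rightarrow> 'a \<Rightarrow> 'a::complex_vector" "scaleC :: complex \<Rightarrow> 'b \<Rightarrow> 'b::complex_vector"
  ..

abbreviation clinear :: "('a::complex_vector \<Rightarrow> 'b::complex_vector) \<Rightarrow> bool"
  where "clinear \<equiv> Vector_Spaces.linear scaleC scaleC"

lemma clinear_iff:
  "clinear f \<longleftrightarrow> (\<forall>x y. f (x + y) = f x + f y) \<and> (\<forall>c x. f (c *\<^sub>C x) = c *\<^sub>C f x)"
  by (simp add: Vector_Spaces.linear_iff cvec.vector_space_axioms)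

lemma clinearI:
  assumes "\<And>x y. f (x + y) = f x + f y" and "\<And>c x. f (c *\<^sub>C x) = c *\<^sub>C f x"
  shows "clinear f"
  using assms by (simp add: clinear_iff)

lemma clinear_add: "clinear f \<Longrightarrow> f (x + y) = f x + f y"
  and clinear_scale: "clinear f \<Longrightarrow> f (c *\<^sub>C x) = c *\<^sub>C f x"
  by (simp_all add: clinear_iff)

lemma clinear_0: "clinear f \<Longrightarrow> f 0 = 0"
  and clinear_diff: "clinear f \<Longrightarrow> f (x - y) = f x - f y"
  and clinear_sum: "clinear f \<Longrightarrow> f (sum g S) = (\<Sum>a\<in>S. f (g a))"
  by (simp_all add: cvec_pair.linear_0 cvec_pair.linear_diff cvec_pair.linear_sum)

definition cbilinear ::
    "('a::complex_vector \<Rightarrow> 'b::complex_vector \<Rightarrow> 'c::complex_vector) \<Rightarrow> bool" where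
  "cbilinear f \<longleftrightarrow> (\<forall>y. clinear (\<lambda>x. f x y)) \<and> (\<forall>x. clinear (f x))"

instantiation complex :: complex_algebra_1
begin

definition scaleC_complex :: "complex \<Rightarrow> complex \<Rightarrow> complex" where
  "scaleC_complex = (*)"

instance
  by standard (simp_all add: scaleC_complex_def algebra_simps)

end

text \<open>
  \<^term>\<open>proj_along A B\<close> is the projection onto \<^term>\<open>A\<close> along \<^term>\<open>B\<close>; it is meaningful only
  when the ambient space is the direct sum of the subspaces \<^term>\<open>A\<close> and \<^term>\<open>B\<close>.
\<close>

definition direct_sum :: "'a::ab_group_add set \<Rightarrow> 'a set \<Rightarrow> 'a set \<Rightarrow> bool" where
  "direct_sum A B C \<longleftrightarrow> A \<inter> B = {0} \<and> C = {a + b |a b. a \<in> A \<and> b \<in> B}"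

definition proj_along :: "'a::ab_group_add set \<Rightarrow> 'a set \<Rightarrow> 'a \<Rightarrow> 'a" where
  "proj_along A B x = (THE a. a \<in> A \<and> x - a \<in> B)"


section \<open>Free vector spaces and free algebras\<close>

text \<open>
  The free vector space on a type \<^typ>\<open>'k\<close> is \<^typ>\<open>'k \<Rightarrow>\<^sub>0 complex\<close>. Since lists form a monoid under
  concatenation, the convolution product of \<^typ>\<open>'g list \<Rightarrow>\<^sub>0 complex\<close> makes it the free unital
  associative algebra on the set of generators \<^typ>\<open>'g\<close>.
\<close>

instantiation poly_mapping :: (type, complex_vector) complex_vector
begin

definition scaleC_poly_mapping :: "complex \<Rightarrow> ('a \<Rightarrow>\<^sub>0 'b) \<Rightarrow> 'a \<Rightarrow>\<^sub>0 'b" where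
  "scaleC_poly_mapping c p = Poly_Mapping.map (scaleC c) p"

lemma lookup_scaleC: "Poly_Mapping.lookup (c *\<^sub>C p) k = c *\<^sub>C Poly_Mapping.lookup p k"
  for p :: "'a \<Rightarrow>\<^sub>0 'b"
  unfolding scaleC_poly_mapping_def
  by transfer (auto simp: when_def cvec.scale_zero_right)

instance
  by standard
    (auto intro!: poly_mapping_eqI simp: lookup_scaleC lookup_add
      scaleC_add_right scaleC_add_left scaleC_scaleC scaleC_one)

end

lemma scaleC_single: "c *\<^sub>C Poly_Mapping.single k a = Poly_Mapping.single k (c *\<^sub>C a)"
  by (rule poly_mapping_eqI) (simp add: lookup_scaleC lookup_single when_def)

definition lin_ext :: "('k \<Rightarrow> 'a::complex_vector) \<Rightarrow> ('k \<Rightarrow>\<^sub>0 complex) \<Rightarrow> 'a" where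
  "lin_ext f p = (\<Sum>k\<in>Poly_Mapping.keys p. Poly_Mapping.lookup p k *\<^sub>C f k)"

lemma lin_ext_superset:
  assumes "finite S" "Poly_Mapping.keys p \<subseteq> S"
  shows "lin_ext f p = (\<Sum>k\<in>S. Poly_Mapping.lookup p k *\<^sub>C f k)"
  unfolding lin_ext_def using assms
  by (intro sum.mono_neutral_left) (auto simp: in_keys_iff)

lemma clinear_lin_ext: "clinear (lin_ext f)"
proof (rule clinearI)
  fix p q :: "'a \<Rightarrow>\<^sub>0 complex"
  let ?S = "Poly_Mapping.keys p \<union> Poly_Mapping.keys q"
  have "lin_ext f (p + q) = (\<Sum>k\<in>?S. Poly_Mapping.lookup (p + q) k *\<^sub>C f k)"
    using keys_add[of p q] by (intro lin_ext_superset) auto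
  also have "\<dots> = (\<Sum>k\<in>?S. Poly_Mapping.lookup p k *\<^sub>C f k) + (\<Sum>k\<in>?S. Poly_Mapping.lookup q k *\<^sub>C f k)"
    by (simp add: lookup_add scaleC_add_left sum.distrib)
  also have "\<dots> = lin_ext f p + lin_ext f q"
    by (simp add: lin_ext_superset[of ?S p] lin_ext_superset[of ?S q])
  finally show "lin_ext f (p + q) = lin_ext f p + lin_ext f q" .
next
  fix c and p :: "'a \<Rightarrow>\<^sub>0 complex"
  have "lin_ext f (c *\<^sub>C p) = (\<Sum>k\<in>Poly_Mapping.keys p. Poly_Mapping.lookup (c *\<^sub>C p) k *\<^sub>C f k)"
    by (intro lin_ext_superset) (auto simp: in_keys_iff lookup_scaleC scaleC_complex_def)
  also have "\<dots> = c *\<^sub>C lin_ext f p"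
    by (simp add: lin_ext_def lookup_scaleC scaleC_complex_def cvec.scale_sum_right scaleC_scaleC)
  finally show "lin_ext f (c *\<^sub>C p) = c *\<^sub>C lin_ext f p" .
qed

lemma lin_ext_single: "lin_ext f (Poly_Mapping.single k c) = c *\<^sub>C f k"
  by (simp add: lin_ext_def)

lemma poly_mapping_sum_single:
  "p = (\<Sum>k\<in>Poly_Mapping.keys p. Poly_Mapping.single k (Poly_Mapping.lookup p k))"
  by (rule poly_mapping_eqI)
    (auto simp: lookup_sum lookup_single when_def in_keys_iff)

lemma clinear_eq_on_singles:
  fixes f g :: "('k \<Rightarrow>\<^sub>0 complex) \<Rightarrow> 'a::complex_vector"
  assumes "clinear f" "clinear g"
    and "\<And>k. f (Poly_Mapping.single k 1) = g (Poly_Mapping.single k 1)"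
  shows "f p = g p"
proof -
  have "f (Poly_Mapping.single k c) = g (Poly_Mapping.single k c)" for k c
    using clinear_scale[OF assms(1), of c "Poly_Mapping.single k 1"]
      clinear_scale[OF assms(2), of c "Poly_Mapping.single k 1"] assms(3)[of k]
    by (simp add: scaleC_single scaleC_complex_def)
  then have "f (\<Sum>k\<in>Poly_Mapping.keys p. Poly_Mapping.single k (Poly_Mapping.lookup p k))
      = g (\<Sum>k\<in>Poly_Mapping.keys p. Poly_Mapping.single k (Poly_Mapping.lookup p k))"
    by (simp only: clinear_sum[OF assms(1)] clinear_sum[OF assms(2)])
  then show ?thesis
    by (simp only: poly_mapping_sum_single[symmetric])
qed

instantiation list :: (type) monoid_add
begin

definition zero_list :: "'a list" where "zero_list = []"
definition plus_list :: "'a list \<Rightarrow> 'a list \<Rightarrow> 'a list" where "plus_list = (@)"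

instance
  by standard (simp_all add: zero_list_def plus_list_def)

end

instance poly_mapping :: (monoid_add, complex_algebra_1) complex_algebra_1
proof
  fix c :: complex and x y :: "'a \<Rightarrow>\<^sub>0 'b"
  have s: "c *\<^sub>C p = Poly_Mapping.single 0 (c *\<^sub>C 1) * p" for p :: "'a \<Rightarrow>\<^sub>0 'b"
  proof -
    have "c *\<^sub>C p = Poly_Mapping.map ((*) (c *\<^sub>C 1 :: 'b)) p"
      unfolding scaleC_poly_mapping_def
      by (rule arg_cong[where f = "\<lambda>g. Poly_Mapping.map g p"]) (auto simp: mult_scaleC_left)
    then show ?thesis
      by (simp only: mult_map_scale_conv_mult)
  qed
  show "(c *\<^sub>C x) * y = c *\<^sub>C (x * y)"
    by (simp add: s mult.assoc)
  have comm: "x * Poly_Mapping.single 0 (c *\<^sub>C 1) = Poly_Mapping.single 0 (c *\<^sub>C 1) * x"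
    for x :: "'a \<Rightarrow>\<^sub>0 'b"
  proof -
    note x = poly_mapping_sum_single[of x]
    have "x * Poly_Mapping.single 0 (c *\<^sub>C 1)
        = (\<Sum>k\<in>Poly_Mapping.keys x.
            Poly_Mapping.single k (Poly_Mapping.lookup x k) * Poly_Mapping.single 0 (c *\<^sub>C 1))"
      using arg_cong[OF x, of "\<lambda>y. y * Poly_Mapping.single 0 (c *\<^sub>C 1)"]
      by (simp only: sum_distrib_right)
    also have "\<dots> = (\<Sum>k\<in>Poly_Mapping.keys x.
            Poly_Mapping.single 0 (c *\<^sub>C 1) * Poly_Mapping.single k (Poly_Mapping.lookup x k))"
      by (simp add: mult_single mult_scaleC_left mult_scaleC_right)
    also have "\<dots> = Poly_Mapping.single 0 (c *\<^sub>C 1) * x"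
      using arg_cong[OF x, of "\<lambda>y. Poly_Mapping.single 0 (c *\<^sub>C 1) * y"]
      by (simp only: sum_distrib_left)
    finally show ?thesis .
  qed
  show "x * (c *\<^sub>C y) = c *\<^sub>C (x * y)"
    by (simp add: s comm mult.assoc[symmetric])
qed

definition free_eval :: "('g \<Rightarrow> 'a::complex_algebra_1) \<Rightarrow> ('g list \<Rightarrow>\<^sub>0 complex) \<Rightarrow> 'a" where
  "free_eval f = lin_ext (\<lambda>w. prod_list (map f w))"

lemma clinear_free_eval: "clinear (free_eval f)"
  by (simp add: free_eval_def clinear_lin_ext)

lemma free_eval_single: "free_eval f (Poly_Mapping.single w c) = c *\<^sub>C prod_list (map f w)"
  by (simp add: free_eval_def lin_ext_single)

lemma free_eval_1: "free_eval f 1 = 1"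
  using free_eval_single[of f 0 1] by (simp add: scaleC_one) (simp add: zero_list_def)

lemma free_eval_mult: "free_eval f (p * q) = free_eval f p * free_eval f q"
proof -
  have lin: "clinear (\<lambda>x. free_eval f (x * b))" "clinear (\<lambda>x. free_eval f (b * x))"
    "clinear (\<lambda>x. free_eval f x * d)" "clinear (\<lambda>x. d * free_eval f x)" for b d
    by (rule clinearI;
        simp add: distrib_left distrib_right mult_scaleC_left mult_scaleC_right
          clinear_add[OF clinear_free_eval] clinear_scale[OF clinear_free_eval])+
  have "free_eval f (Poly_Mapping.single v 1 * q) = free_eval f (Poly_Mapping.single v 1) * free_eval f q"
    for v
    by (rule clinear_eq_on_singles[OF lin(2,4)])
      (simp add: mult_single free_eval_single plus_list_def scaleC_one)
  then show ?thesis
    by (rule clinear_eq_on_singles[OF lin(1,3)])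
qed


section \<open>Lie algebras and universal enveloping algebras\<close>

class lie_algebra = complex_vector +
  fixes lie_bracket :: "'a \<Rightarrow> 'a \<Rightarrow> 'a"
  assumes lie_bracket_add_left: "lie_bracket (x + y) z = lie_bracket x z + lie_bracket y z"
    and lie_bracket_add_right: "lie_bracket x (y + z) = lie_bracket x y + lie_bracket x z"
    and lie_bracket_scale_left: "lie_bracket (c *\<^sub>C x) y = c *\<^sub>C lie_bracket x y"
    and lie_bracket_scale_right: "lie_bracket x (c *\<^sub>C y) = c *\<^sub>C lie_bracket x y"
    and lie_bracket_self: "lie_bracket x x = 0"
    and lie_jacobi: "lie_bracket x (lie_bracket y z) + lie_bracket y (lie_bracket z x)
                     + lie_bracket z (lie_bracket x y) = 0"

definition finite_dimensional :: "'a::complex_vector set \<Rightarrow> bool" where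
  "finite_dimensional V \<longleftrightarrow> (\<exists>B. finite B \<and> cvec.span B = V)"

definition lie_subalgebra :: "'g::lie_algebra set \<Rightarrow> bool" where
  "lie_subalgebra S \<longleftrightarrow> cvec.subspace S \<and> (\<forall>x\<in>S. \<forall>y\<in>S. lie_bracket x y \<in> S)"

definition abelian_lie_subalgebra :: "'g::lie_algebra set \<Rightarrow> bool" where
  "abelian_lie_subalgebra S \<longleftrightarrow> lie_subalgebra S \<and> (\<forall>x\<in>S. \<forall>y\<in>S. lie_bracket x y = 0)"

text \<open>
  The enveloping algebra is presented by generators and relations: it is the free algebra on the set
  \<^typ>\<open>'g\<close> modulo the two-sided ideal forcing the inclusion of generators to be linear (which
  yields the tensor algebra) and to turn brackets into commutators.
\<close>

inductive_set uea_ideal :: "('g::lie_algebra list \<Rightarrow>\<^sub>0 complex) set" where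
  gen_add: "Poly_Mapping.single [x + y] 1 - Poly_Mapping.single [x] 1 - Poly_Mapping.single [y] 1
              \<in> uea_ideal"
| gen_scale: "Poly_Mapping.single [c *\<^sub>C x] 1 - c *\<^sub>C Poly_Mapping.single [x] 1 \<in> uea_ideal"
| gen_bracket: "Poly_Mapping.single [x] 1 * Poly_Mapping.single [y] 1
                 - Poly_Mapping.single [y] 1 * Poly_Mapping.single [x] 1
                 - Poly_Mapping.single [lie_bracket x y] 1 \<in> uea_ideal"
| zero: "0 \<in> uea_ideal"
| add: "p \<in> uea_ideal \<Longrightarrow> q \<in> uea_ideal \<Longrightarrow> p + q \<in> uea_ideal"
| mult: "p \<in> uea_ideal \<Longrightarrow> a * p * b \<in> uea_ideal"

lemma uea_ideal_mult_left: "p \<in> uea_ideal \<Longrightarrow> a * p \<in> uea_ideal"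
  using uea_ideal.mult[of p a 1] by simp

lemma uea_ideal_mult_right: "p \<in> uea_ideal \<Longrightarrow> p * a \<in> uea_ideal"
  using uea_ideal.mult[of p 1 a] by simp

lemma uea_ideal_uminus: "p \<in> uea_ideal \<Longrightarrow> - p \<in> uea_ideal"
  using uea_ideal_mult_left[of p "-1"] by simp

lemma uea_ideal_scale: "p \<in> uea_ideal \<Longrightarrow> c *\<^sub>C p \<in> uea_ideal"
  using uea_ideal_mult_left[of p "c *\<^sub>C 1"] by (simp add: mult_scaleC_left)

lemma uea_ideal_diff: "p \<in> uea_ideal \<Longrightarrow> q \<in> uea_ideal \<Longrightarrow> p - q \<in> uea_ideal"
  using uea_ideal.add[OF _ uea_ideal_uminus, of p q] by simp

lemma uea_ideal_eqI: "p = q \<Longrightarrow> p - q \<in> uea_ideal"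
  by (simp add: uea_ideal.zero)

quotient_type (overloaded) 'g uea =
    "'g::lie_algebra list \<Rightarrow>\<^sub>0 complex" / "\<lambda>p q. p - q \<in> uea_ideal"
proof (rule equivpI)
  show "reflp (\<lambda>p q :: 'g list \<Rightarrow>\<^sub>0 complex. p - q \<in> uea_ideal)"
    by (rule reflpI) (simp add: uea_ideal.zero)
  show "symp (\<lambda>p q :: 'g list \<Rightarrow>\<^sub>0 complex. p - q \<in> uea_ideal)"
  proof (rule sympI)
    fix p q :: "'g list \<Rightarrow>\<^sub>0 complex"
    assume "p - q \<in> uea_ideal"
    from uea_ideal_uminus[OF this] show "q - p \<in> uea_ideal" by simp
  qed
  show "transp (\<lambda>p q :: 'g list \<Rightarrow>\<^sub>0 complex. p - q \<in> uea_ideal)"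
  proof (rule transpI)
    fix p q r :: "'g list \<Rightarrow>\<^sub>0 complex"
    assume "p - q \<in> uea_ideal" "q - r \<in> uea_ideal"
    from uea_ideal.add[OF this] show "p - r \<in> uea_ideal" by simp
  qed
qed

definition lie_hom :: "('g::lie_algebra \<Rightarrow> 'a::complex_algebra_1) \<Rightarrow> bool" where
  "lie_hom f \<longleftrightarrow> clinear f \<and> (\<forall>x y. f (lie_bracket x y) = f x * f y - f y * f x)"

lemma free_eval_uea_ideal:
  assumes "lie_hom f" "p \<in> uea_ideal"
  shows "free_eval f p = 0"
proof -
  have f: "f (x + y) = f x + f y" "f (c *\<^sub>C x) = c *\<^sub>C f x"
    "f (lie_bracket x y) = f x * f y - f y * f x" for x y c
    using assms(1) by (simp_all add: lie_hom_def clinear_iff)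
  note lin = clinear_add[OF clinear_free_eval] clinear_scale[OF clinear_free_eval]
    clinear_diff[OF clinear_free_eval] clinear_0[OF clinear_free_eval]
  have gen: "free_eval f (Poly_Mapping.single [x] 1) = f x" for x
    by (simp add: free_eval_single scaleC_one)
  show ?thesis
    using assms(2)
  proof induction
    case (gen_add x y)
    then show ?case by (simp only: lin gen f) simp
  next
    case (gen_scale c x)
    then show ?case by (simp only: lin gen f) simp
  next
    case (gen_bracket x y)
    then show ?case by (simp only: lin gen f free_eval_mult) simp
  next
    case zero
    then show ?case by (simp only: lin)
  next
    case (add p q)
    then show ?case by (simp only: lin) simp
  next
    case (mult p a b)
    then show ?case by (simp only: free_eval_mult) simp
  qed
qed

lemma lie_hom_zero: "lie_hom (\<lambda>_. 0)"
  by (simp add: lie_hom_def clinearI)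

instantiation uea :: (lie_algebra) complex_algebra_1
begin

lift_definition zero_uea :: "'a uea" is 0 .
lift_definition one_uea :: "'a uea" is 1 .
lift_definition plus_uea :: "'a uea \<Rightarrow> 'a uea \<Rightarrow> 'a uea" is "(+)"
  by (drule (1) uea_ideal.add) (simp add: algebra_simps)
lift_definition uminus_uea :: "'a uea \<Rightarrow> 'a uea" is uminus
  by (drule uea_ideal_uminus) simp
lift_definition minus_uea :: "'a uea \<Rightarrow> 'a uea \<Rightarrow> 'a uea" is "(-)"
  by (drule (1) uea_ideal_diff) (simp add: algebra_simps)
lift_definition times_uea :: "'a uea \<Rightarrow> 'a uea \<Rightarrow> 'a uea" is "(*)"
proof -
  fix a a' b b' :: "'a list \<Rightarrow>\<^sub>0 complex"
  assume "a - a' \<in> uea_ideal" "b - b' \<in> uea_ideal"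
  then have "(a - a') * b + a' * (b - b') \<in> uea_ideal"
    by (intro uea_ideal.add uea_ideal_mult_left uea_ideal_mult_right)
  then show "a * b - a' * b' \<in> uea_ideal"
    by (simp add: algebra_simps)
qed
lift_definition scaleC_uea :: "complex \<Rightarrow> 'a uea \<Rightarrow> 'a uea" is scaleC
  by (drule uea_ideal_scale) (simp add: cvec.scale_right_diff_distrib)

instance
proof
  show "(0 :: 'a uea) \<noteq> 1"
  proof (transfer, rule notI)
    assume "(0 :: 'a list \<Rightarrow>\<^sub>0 complex) - 1 \<in> uea_ideal"
    then have "free_eval (\<lambda>_. 0 :: complex) (0 - 1 :: 'a list \<Rightarrow>\<^sub>0 complex) = 0"
      by (rule free_eval_uea_ideal[OF lie_hom_zero])
    then show False
      by (simp only: clinear_diff[OF clinear_free_eval] clinear_0[OF clinear_free_eval] free_eval_1)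
        simp
  qed
qed (transfer, rule uea_ideal_eqI, (rule add.assoc add.commute mult.assoc distrib_left distrib_right
      scaleC_add_right scaleC_add_left scaleC_scaleC scaleC_one mult_scaleC_left mult_scaleC_right | simp))+

end

lift_definition uea_gen :: "'g::lie_algebra \<Rightarrow> 'g uea" is "\<lambda>x. Poly_Mapping.single [x] 1" .

text \<open>
  The algebra homomorphism induced by a Lie algebra homomorphism; the lemmas below
  are the universal property. For \<^term>\<open>f\<close> that is not a Lie homomorphism the value is junk.
\<close>

definition uea_lift :: "('g::lie_algebra \<Rightarrow> 'a::complex_algebra_1) \<Rightarrow> 'g uea \<Rightarrow> 'a" where
  "uea_lift f u = free_eval f (rep_uea u)"

lemma lie_hom_uea_gen: "lie_hom uea_gen"
  unfolding lie_hom_def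
proof (intro conjI allI clinearI)
  fix x y :: 'a and c :: complex
  show "uea_gen (x + y) = uea_gen x + uea_gen y"
    by transfer (use uea_ideal.gen_add in \<open>simp add: diff_diff_eq\<close>)
  show "uea_gen (c *\<^sub>C x) = c *\<^sub>C uea_gen x"
    by transfer (rule uea_ideal.gen_scale)
  show "uea_gen (lie_bracket x y) = uea_gen x * uea_gen y - uea_gen y * uea_gen x"
    by transfer (use uea_ideal_uminus[OF uea_ideal.gen_bracket] in simp)
qed

lemma uea_lift_abs:
  assumes "lie_hom f"
  shows "uea_lift f (abs_uea p) = free_eval f p"
proof -
  have "rep_uea (abs_uea p) - p \<in> uea_ideal"
    using Quotient3_rep_abs[OF Quotient3_uea] by (simp add: uea_ideal.zero)
  from free_eval_uea_ideal[OF assms this] show ?thesis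
    by (simp add: uea_lift_def clinear_diff[OF clinear_free_eval])
qed

lemma
  assumes "lie_hom f"
  shows uea_lift_add: "uea_lift f (u + v) = uea_lift f u + uea_lift f v"
    and uea_lift_scale: "uea_lift f (c *\<^sub>C u) = c *\<^sub>C uea_lift f u"
    and uea_lift_mult: "uea_lift f (u * v) = uea_lift f u * uea_lift f v"
    and uea_lift_1: "uea_lift f 1 = 1"
    and uea_lift_gen: "uea_lift f (uea_gen x) = f x"
proof -
  obtain p q where "u = abs_uea p" "v = abs_uea q"
    by (metis Quotient3_abs_rep[OF Quotient3_uea])
  then show "uea_lift f (u + v) = uea_lift f u + uea_lift f v"
    "uea_lift f (c *\<^sub>C u) = c *\<^sub>C uea_lift f u"
    "uea_lift f (u * v) = uea_lift f u * uea_lift f v"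
    by (simp_all add: plus_uea.abs_eq scaleC_uea.abs_eq times_uea.abs_eq uea_lift_abs[OF assms]
        clinear_add[OF clinear_free_eval] clinear_scale[OF clinear_free_eval] free_eval_mult)
  show "uea_lift f 1 = 1" "uea_lift f (uea_gen x) = f x"
    by (simp_all add: one_uea_def uea_gen.abs_eq uea_lift_abs[OF assms] free_eval_1
        free_eval_single scaleC_one)
qed

lemma clinear_uea_lift: "lie_hom f \<Longrightarrow> clinear (uea_lift f)"
  by (rule clinearI) (simp_all add: uea_lift_add uea_lift_scale)

lemma uea_lift_unique:
  fixes F :: "'a::lie_algebra uea \<Rightarrow> 'b::complex_algebra_1"
  assumes "clinear F" "F 1 = 1" "\<And>u v. F (u * v) = F u * F v" "\<And>x. F (uea_gen x) = f x"
  shows "F = uea_lift f"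
proof -
  have hom: "lie_hom f"
    unfolding lie_hom_def
  proof (intro conjI allI clinearI)
    fix x y :: 'a and c
    have g: "uea_gen (x + y) = uea_gen x + uea_gen y" "uea_gen (c *\<^sub>C x) = c *\<^sub>C uea_gen x"
      "uea_gen (lie_bracket x y) = uea_gen x * uea_gen y - uea_gen y * uea_gen x"
      using lie_hom_uea_gen by (auto simp: lie_hom_def clinear_iff)
    show "f (x + y) = f x + f y"
      by (simp add: assms(4)[symmetric] g clinear_add[OF assms(1)])
    show "f (c *\<^sub>C x) = c *\<^sub>C f x"
      by (simp add: assms(4)[symmetric] g clinear_scale[OF assms(1)])
    show "f (lie_bracket x y) = f x * f y - f y * f x"
      by (simp add: assms(4)[symmetric] g clinear_diff[OF assms(1)] assms(3))
  qed
  have lin: "clinear (\<lambda>p. F (abs_uea p))"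
    by (rule clinearI)
      (simp_all add: plus_uea.abs_eq[symmetric] scaleC_uea.abs_eq[symmetric]
        clinear_add[OF assms(1)] clinear_scale[OF assms(1)])
  have "F (abs_uea (Poly_Mapping.single w 1)) = prod_list (map f w)" for w
  proof (induction w)
    case Nil
    have "abs_uea (Poly_Mapping.single [] 1) = (1 :: 'a uea)"
      by (metis one_uea_def single_one zero_list_def)
    then show ?case by (simp add: assms(2))
  next
    case (Cons x w)
    have "abs_uea (Poly_Mapping.single (x # w) 1) = uea_gen x * abs_uea (Poly_Mapping.single w 1)"
      by (simp add: uea_gen.abs_eq times_uea.abs_eq mult_single plus_list_def)
    then show ?case by (simp add: assms(3,4) Cons)
  qed
  then have "F (abs_uea p) = free_eval f p" for p
    by - (rule clinear_eq_on_singles[OF lin clinear_free_eval], simp add: free_eval_single scaleC_one)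
  then show ?thesis
    using uea_lift_abs[OF hom] by (metis Quotient3_abs_rep[OF Quotient3_uea] ext)
qed


section \<open>Tensor products\<close>

definition tensor_relations :: "('a::complex_vector \<times> 'b::complex_vector \<Rightarrow>\<^sub>0 complex) set" where
  "tensor_relations = cvec.span (
     {Poly_Mapping.single (a + a', b) 1 - Poly_Mapping.single (a, b) 1
        - Poly_Mapping.single (a', b) 1 |a a' b. True} \<union>
     {Poly_Mapping.single (a, b + b') 1 - Poly_Mapping.single (a, b) 1
        - Poly_Mapping.single (a, b') 1 |a b b'. True} \<union>
     {Poly_Mapping.single (c *\<^sub>C a, b) 1 - c *\<^sub>C Poly_Mapping.single (a, b) 1 |c a b. True} \<union>
     {Poly_Mapping.single (a, c *\<^sub>C b) 1 - c *\<^sub>C Poly_Mapping.single (a, b) 1 |c a b. True})"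

lemma tensor_relations_subspace:
  "0 \<in> tensor_relations"
  "p \<in> tensor_relations \<Longrightarrow> q \<in> tensor_relations \<Longrightarrow> p + q \<in> tensor_relations"
  "p \<in> tensor_relations \<Longrightarrow> q \<in> tensor_relations \<Longrightarrow> p - q \<in> tensor_relations"
  "p \<in> tensor_relations \<Longrightarrow> - p \<in> tensor_relations"
  "p \<in> tensor_relations \<Longrightarrow> c *\<^sub>C p \<in> tensor_relations"
  unfolding tensor_relations_def
  by (auto intro: cvec.span_zero cvec.span_add cvec.span_diff cvec.span_neg cvec.span_scale)

lemma tensor_relations_eqI: "p = q \<Longrightarrow> p - q \<in> tensor_relations"
  by (simp add: tensor_relations_subspace)

quotient_type (overloaded) ('a, 'b) tensor =
    "'a::complex_vector \<times> 'b::complex_vector \<Rightarrow>\<^sub>0 complex" / "\<lambda>p q. p - q \<in> tensor_relations"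
proof (rule equivpI)
  show "reflp (\<lambda>p q :: 'a \<times> 'b \<Rightarrow>\<^sub>0 complex. p - q \<in> tensor_relations)"
    by (rule reflpI) (simp add: tensor_relations_subspace)
  show "symp (\<lambda>p q :: 'a \<times> 'b \<Rightarrow>\<^sub>0 complex. p - q \<in> tensor_relations)"
  proof (rule sympI)
    fix p q :: "'a \<times> 'b \<Rightarrow>\<^sub>0 complex"
    assume "p - q \<in> tensor_relations"
    from tensor_relations_subspace(4)[OF this] show "q - p \<in> tensor_relations" by simp
  qed
  show "transp (\<lambda>p q :: 'a \<times> 'b \<Rightarrow>\<^sub>0 complex. p - q \<in> tensor_relations)"
  proof (rule transpI)
    fix p q r :: "'a \<times> 'b \<Rightarrow>\<^sub>0 complex"
    assume "p - q \<in> tensor_relations" "q - r \<in> tensor_relations"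
    from tensor_relations_subspace(2)[OF this] show "p - r \<in> tensor_relations" by simp
  qed
qed

instantiation tensor :: (complex_vector, complex_vector) complex_vector
begin

lift_definition zero_tensor :: "('a, 'b) tensor" is 0 .
lift_definition plus_tensor :: "('a, 'b) tensor \<Rightarrow> ('a, 'b) tensor \<Rightarrow> ('a, 'b) tensor" is "(+)"
  by (drule (1) tensor_relations_subspace(2)) (simp add: algebra_simps)
lift_definition uminus_tensor :: "('a, 'b) tensor \<Rightarrow> ('a, 'b) tensor" is uminus
  by (drule tensor_relations_subspace(4)) simp
lift_definition minus_tensor :: "('a, 'b) tensor \<Rightarrow> ('a, 'b) tensor \<Rightarrow> ('a, 'b) tensor" is "(-)"
  by (drule (1) tensor_relations_subspace(3)) (simp add: algebra_simps)
lift_definition scaleC_tensor :: "complex \<Rightarrow> ('a, 'b) tensor \<Rightarrow> ('a, 'b) tensor" is scaleC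
  by (drule tensor_relations_subspace(5)) (simp add: cvec.scale_right_diff_distrib)

instance
  by standard (transfer, rule tensor_relations_eqI, (rule add.assoc add.commute
      scaleC_add_right scaleC_add_left scaleC_scaleC scaleC_one | simp))+

end

lift_definition pure_tensor :: "'a::complex_vector \<Rightarrow> 'b::complex_vector \<Rightarrow> ('a, 'b) tensor"
    (infixr \<open>\<otimes>\<close> 72)
  is "\<lambda>a b. Poly_Mapping.single (a, b) 1" .

text \<open>
  The linear map on the tensor product induced by a bilinear map (junk for maps that are not
  bilinear).
\<close>

definition tensor_lift ::
    "('a::complex_vector \<Rightarrow> 'b::complex_vector \<Rightarrow> 'c::complex_vector) \<Rightarrow> ('a, 'b) tensor \<Rightarrow> 'c" where
  "tensor_lift f t = lin_ext (\<lambda>(a, b). f a b) (rep_tensor t)"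

lemma cbilinearD:
  assumes "cbilinear f"
  shows "f (a + a') b = f a b + f a' b" "f a (b + b') = f a b + f a b'"
    "f (c *\<^sub>C a) b = c *\<^sub>C f a b" "f a (c *\<^sub>C b) = c *\<^sub>C f a b"
  using assms by (auto simp: cbilinear_def clinear_iff)

lemma cbilinearI:
  assumes "\<And>a a' b. f (a + a') b = f a b + f a' b" "\<And>a b b'. f a (b + b') = f a b + f a b'"
    "\<And>c a b. f (c *\<^sub>C a) b = c *\<^sub>C f a b" "\<And>c a b. f a (c *\<^sub>C b) = c *\<^sub>C f a b"
  shows "cbilinear f"
  using assms by (auto simp: cbilinear_def clinear_iff)

lemma cbilinear_pure_tensor: "cbilinear (\<otimes>)"
proof (rule cbilinearI; transfer)
  fix a a' :: 'a and b b' :: 'b and c :: complex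
  show "Poly_Mapping.single (a + a', b) 1 - (Poly_Mapping.single (a, b) 1 + Poly_Mapping.single (a', b) 1)
      \<in> tensor_relations"
    unfolding tensor_relations_def diff_diff_eq[symmetric]
    by (rule cvec.span_base) blast
  show "Poly_Mapping.single (a, b + b') 1 - (Poly_Mapping.single (a, b) 1 + Poly_Mapping.single (a, b') 1)
      \<in> tensor_relations"
    unfolding tensor_relations_def diff_diff_eq[symmetric]
    by (rule cvec.span_base) blast
  show "Poly_Mapping.single (c *\<^sub>C a, b) 1 - c *\<^sub>C Poly_Mapping.single (a, b) 1 \<in> tensor_relations"
    unfolding tensor_relations_def by (rule cvec.span_base) blast
  show "Poly_Mapping.single (a, c *\<^sub>C b) 1 - c *\<^sub>C Poly_Mapping.single (a, b) 1 \<in> tensor_relations"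
    unfolding tensor_relations_def by (rule cvec.span_base) blast
qed

lemmas pure_tensor_simps = cbilinearD[OF cbilinear_pure_tensor]

lemma lin_ext_tensor_relations:
  assumes "cbilinear f" "p \<in> tensor_relations"
  shows "lin_ext (\<lambda>(a, b). f a b) p = 0"
  using assms(2) unfolding tensor_relations_def
proof (induction rule: cvec.span_induct)
  case base
  then show ?case
    by (simp add: cvec.subspace_def clinear_0[OF clinear_lin_ext] clinear_add[OF clinear_lin_ext]
        clinear_scale[OF clinear_lin_ext])
next
  case (step x)
  then show ?case
    by (auto simp: clinear_diff[OF clinear_lin_ext] clinear_scale[OF clinear_lin_ext]
        lin_ext_single scaleC_one cbilinearD[OF assms(1)])
qed

lemma tensor_lift_abs:
  assumes "cbilinear f"
  shows "tensor_lift f (abs_tensor p) = lin_ext (\<lambda>(a, b). f a b) p"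
proof -
  have "rep_tensor (abs_tensor p) - p \<in> tensor_relations"
    using Quotient3_rep_abs[OF Quotient3_tensor] by (simp add: tensor_relations_subspace)
  from lin_ext_tensor_relations[OF assms this] show ?thesis
    by (simp add: tensor_lift_def clinear_diff[OF clinear_lin_ext])
qed

lemma tensor_lift_pure: "cbilinear f \<Longrightarrow> tensor_lift f (a \<otimes> b) = f a b"
  by (simp add: pure_tensor.abs_eq tensor_lift_abs lin_ext_single scaleC_one)

lemma clinear_tensor_lift: 
  assumes "cbilinear f"
  shows "clinear (tensor_lift f)"
proof (rule clinearI)
  fix s t :: "('a, 'b) tensor" and c
  obtain p q where "s = abs_tensor p" "t = abs_tensor q"
    by (metis Quotient3_abs_rep[OF Quotient3_tensor])
  then show "tensor_lift f (s + t) = tensor_lift f s + tensor_lift f t"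
    "tensor_lift f (c *\<^sub>C s) = c *\<^sub>C tensor_lift f s"
    by (simp_all add: plus_tensor.abs_eq scaleC_tensor.abs_eq tensor_lift_abs[OF assms]
        clinear_add[OF clinear_lin_ext] clinear_scale[OF clinear_lin_ext])
qed

lemma clinear_eq_on_pure:
  fixes f g :: "('a::complex_vector, 'b::complex_vector) tensor \<Rightarrow> 'c::complex_vector"
  assumes "clinear f" "clinear g" "\<And>a b. f (a \<otimes> b) = g (a \<otimes> b)"
  shows "f t = g t"
proof -
  obtain p where p: "t = abs_tensor p"
    by (metis Quotient3_abs_rep[OF Quotient3_tensor])
  have lin: "clinear (\<lambda>p. h (abs_tensor p))" if "clinear h"
    for h :: "('a, 'b) tensor \<Rightarrow> 'c"
    by (rule clinearI)
      (simp_all add: plus_tensor.abs_eq[symmetric] scaleC_tensor.abs_eq[symmetric]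
        clinear_add[OF that] clinear_scale[OF that])
  show ?thesis
    unfolding p using assms(3)
    by - (rule clinear_eq_on_singles[OF lin[OF assms(1)] lin[OF assms(2)]], auto simp: pure_tensor.abs_eq)
qed

lemma clinear_compose: "clinear f \<Longrightarrow> clinear g \<Longrightarrow> clinear (\<lambda>x. f (g x))"
  by (simp add: clinear_iff)

lemma clinear_lift_param:
  fixes F :: "'p::complex_vector \<Rightarrow> 'a::complex_vector \<Rightarrow> 'b::complex_vector \<Rightarrow> 'c::complex_vector"
  assumes "\<And>x. cbilinear (F x)" "\<And>a b. clinear (\<lambda>x. F x a b)"
  shows "clinear (\<lambda>x. tensor_lift (F x) t)"
proof (rule clinearI)
  fix x y c
  have lin: "clinear (\<lambda>t. tensor_lift (F x) t + tensor_lift (F y) t)"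
    "clinear (\<lambda>t. c *\<^sub>C tensor_lift (F x) t)"
    by (rule clinearI; simp add: clinear_add[OF clinear_tensor_lift[OF assms(1)]]
        clinear_scale[OF clinear_tensor_lift[OF assms(1)]] scaleC_add_right scaleC_scaleC
        mult.commute)+
  show "tensor_lift (F (x + y)) t = tensor_lift (F x) t + tensor_lift (F y) t"
    by (rule clinear_eq_on_pure[OF clinear_tensor_lift[OF assms(1)] lin(1)])
      (simp add: tensor_lift_pure[OF assms(1)] clinear_add[OF assms(2)])
  show "tensor_lift (F (c *\<^sub>C x)) t = c *\<^sub>C tensor_lift (F x) t"
    by (rule clinear_eq_on_pure[OF clinear_tensor_lift[OF assms(1)] lin(2)])
      (simp add: tensor_lift_pure[OF assms(1)] clinear_scale[OF assms(2)])
qed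

lemma cbilinear_compose: "cbilinear f \<Longrightarrow> clinear g \<Longrightarrow> cbilinear (\<lambda>a b. g (f a b))"
  by (simp add: cbilinear_def clinear_iff)

lemma ex_functional:
  fixes x :: "'a::complex_vector"
  assumes "x \<noteq> 0"
  shows "\<exists>\<phi> :: 'a \<Rightarrow> complex. clinear \<phi> \<and> \<phi> x = 1"
proof -
  have "\<not> cvec.dependent {x}"
    using assms by (simp add: cvec.dependent_single)
  from cvec_pair.linear_independent_extend[OF this, of "\<lambda>_. 1"] show ?thesis
    by auto
qed

instantiation tensor :: (complex_algebra_1, complex_algebra_1) complex_algebra_1
begin

definition one_tensor :: "('a, 'b) tensor" where "one_tensor = 1 \<otimes> 1"

definition times_tensor :: "('a, 'b) tensor \<Rightarrow> ('a, 'b) tensor \<Rightarrow> ('a, 'b) tensor" where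
  "times_tensor s t = tensor_lift (\<lambda>a b. tensor_lift (\<lambda>c d. (a * c) \<otimes> (b * d)) t) s"

lemma cbilinear_tmult: "cbilinear (\<lambda>c d. (a * c) \<otimes> (b * d))" for a :: 'a and b :: 'b
  by (rule cbilinearI) (simp_all add: distrib_left pure_tensor_simps mult_scaleC_right)

lemma cbilinear_tmult2: "cbilinear (\<lambda>a b. tensor_lift (\<lambda>c d. (a * c) \<otimes> (b * d)) t)"
  for t :: "('a, 'b) tensor"
proof -
  have "clinear (\<lambda>a. (a * c) \<otimes> (b * d))" "clinear (\<lambda>b. (a * c) \<otimes> (b * d))" for a c :: 'a and b d :: 'b
    by (rule clinearI; simp add: distrib_right pure_tensor_simps mult_scaleC_left)+
  then show ?thesis
    unfolding cbilinear_def by (auto intro: clinear_lift_param[OF cbilinear_tmult])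
qed

lemma tensor_mult_pure: "(a \<otimes> b) * (c \<otimes> d) = (a * c) \<otimes> (b * d)" for a c :: 'a and b d :: 'b
  unfolding times_tensor_def
  by (subst tensor_lift_pure[OF cbilinear_tmult2], rule tensor_lift_pure[OF cbilinear_tmult])

lemma cbilinear_tensor_mult: "cbilinear ((*) :: ('a, 'b) tensor \<Rightarrow> ('a, 'b) tensor \<Rightarrow> ('a, 'b) tensor)"
proof -
  have 1: "clinear (\<lambda>s. s * t)" for t :: "('a, 'b) tensor"
    unfolding times_tensor_def by (rule clinear_tensor_lift[OF cbilinear_tmult2])
  have 2: "clinear (\<lambda>t. s * t)" for s :: "('a, 'b) tensor"
  proof -
    have lin: "clinear (\<lambda>s. s * x + s * y)" "clinear (\<lambda>s. c *\<^sub>C (s * x))"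
      for x y :: "('a, 'b) tensor" and c
      by (rule clinearI; simp add: clinear_add[OF 1] clinear_scale[OF 1] scaleC_add_right
          scaleC_scaleC mult.commute)+
    have p: "clinear (\<lambda>t. (a \<otimes> b) * t)" for a :: 'a and b :: 'b
      unfolding times_tensor_def
      by (simp add: tensor_lift_pure cbilinear_tmult2 clinear_tensor_lift cbilinear_tmult)
    show ?thesis
    proof (rule clinearI)
      fix x y :: "('a, 'b) tensor" and c
      show "s * (x + y) = s * x + s * y"
        by (rule clinear_eq_on_pure[OF 1 lin(1)]) (simp add: clinear_add[OF p])
      show "s * (c *\<^sub>C x) = c *\<^sub>C (s * x)"
        by (rule clinear_eq_on_pure[OF 1 lin(2)]) (simp add: clinear_scale[OF p])
    qed
  qed
  show ?thesis
    using 1 2 by (simp add: cbilinear_def)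
qed

instance
proof
  note b = cbilinearD[OF cbilinear_tensor_mult]
  fix x y z :: "('a, 'b) tensor" and c :: complex
  have L: "clinear (\<lambda>x. x * y)" "clinear (\<lambda>x. y * x)" for y :: "('a, 'b) tensor"
    using cbilinear_tensor_mult by (auto simp: cbilinear_def)
  have I: "clinear (\<lambda>x. x :: ('a, 'b) tensor)"
    by (rule clinearI) auto
  show "(c *\<^sub>C x) * y = c *\<^sub>C (x * y)" "x * (c *\<^sub>C y) = c *\<^sub>C (x * y)"
    "(x + y) * z = x * z + y * z" "x * (y + z) = x * y + x * z"
    by (simp_all add: b)
  have pp: "(x * (a \<otimes> b)) * (a' \<otimes> b') = x * ((a \<otimes> b) * (a' \<otimes> b'))" for a b a' b'
    by (rule clinear_eq_on_pure[OF clinear_compose[OF L(1) L(1)] L(1)])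
      (simp add: tensor_mult_pure mult.assoc)
  have p: "(x * y) * (a' \<otimes> b') = x * (y * (a' \<otimes> b'))" for a' b'
    by (rule clinear_eq_on_pure[OF clinear_compose[OF L(1) L(2)] clinear_compose[OF L(2) L(1)] pp])
  show "x * y * z = x * (y * z)"
    by (rule clinear_eq_on_pure[OF L(2) clinear_compose[OF L(2) L(2)] p])
  show "1 * x = x" "x * 1 = x"
    unfolding one_tensor_def
    by (rule clinear_eq_on_pure[OF L(2) I] clinear_eq_on_pure[OF L(1) I];
        simp add: tensor_mult_pure)+
  obtain \<phi> :: "'a \<Rightarrow> complex" and \<psi> :: "'b \<Rightarrow> complex"
    where f: "clinear \<phi>" "\<phi> 1 = 1" "clinear \<psi>" "\<psi> 1 = 1"
    using ex_functional[of "1::'a"] ex_functional[of "1::'b"] by auto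
  have bil: "cbilinear (\<lambda>a b. \<phi> a * \<psi> b)"
    by (rule cbilinearI)
      (simp_all add: clinear_add[OF f(1)] clinear_add[OF f(3)] clinear_scale[OF f(1)] clinear_scale[OF f(3)]
        algebra_simps mult_scaleC_left mult_scaleC_right)
  show "(0 :: ('a, 'b) tensor) \<noteq> 1"
    using tensor_lift_pure[OF bil, of 1 1] clinear_0[OF clinear_tensor_lift[OF bil]]
    by (auto simp: one_tensor_def f)
qed

end

definition tensor_map :: "('a::complex_vector \<Rightarrow> 'c::complex_vector) \<Rightarrow>
    ('b::complex_vector \<Rightarrow> 'd::complex_vector) \<Rightarrow> ('a, 'b) tensor \<Rightarrow> ('c, 'd) tensor" where
  "tensor_map f g = tensor_lift (\<lambda>a b. f a \<otimes> g b)"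

lemma cbilinear_tensor_map: "clinear f \<Longrightarrow> clinear g \<Longrightarrow> cbilinear (\<lambda>a b. f a \<otimes> g b)"
  by (rule cbilinearI) (simp_all add: clinear_iff pure_tensor_simps)

lemma tensor_map_pure: "clinear f \<Longrightarrow> clinear g \<Longrightarrow> tensor_map f g (a \<otimes> b) = f a \<otimes> g b"
  by (simp add: tensor_map_def tensor_lift_pure cbilinear_tensor_map)

definition tensor_assoc ::
    "('a::complex_vector, ('b::complex_vector, 'c::complex_vector) tensor) tensor
      \<Rightarrow> (('a, 'b) tensor, 'c) tensor" where
  "tensor_assoc = tensor_lift (\<lambda>a. tensor_lift (\<lambda>b c. (a \<otimes> b) \<otimes> c))"

lemma cbilinear_tensor_assoc_aux: "cbilinear (\<lambda>b c. (a \<otimes> b) \<otimes> c)"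
  by (rule cbilinearI) (simp_all add: pure_tensor_simps)

lemma cbilinear_tensor_assoc: "cbilinear (\<lambda>a. tensor_lift (\<lambda>b c. (a \<otimes> b) \<otimes> c))"
  unfolding cbilinear_def
  by (intro conjI allI clinear_lift_param clinear_tensor_lift cbilinear_tensor_assoc_aux)
    (rule clinearI; simp add: pure_tensor_simps)

lemma tensor_assoc_pure: "tensor_assoc (a \<otimes> (b \<otimes> c)) = (a \<otimes> b) \<otimes> c"
  by (simp add: tensor_assoc_def tensor_lift_pure cbilinear_tensor_assoc cbilinear_tensor_assoc_aux)

definition tensor_sub :: "'a::complex_vector set \<Rightarrow> 'b::complex_vector set \<Rightarrow> ('a, 'b) tensor set" where
  "tensor_sub A B = cvec.span {a \<otimes> b |a b. a \<in> A \<and> b \<in> B}"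


section \<open>Hopf structure of the enveloping algebra\<close>

definition comult :: "'g::lie_algebra uea \<Rightarrow> ('g uea, 'g uea) tensor" where
  "comult = uea_lift (\<lambda>x. uea_gen x \<otimes> 1 + 1 \<otimes> uea_gen x)"

definition counit :: "'g::lie_algebra uea \<Rightarrow> complex" where
  "counit = uea_lift (\<lambda>_. 0)"

lemma lie_hom_comult: "lie_hom (\<lambda>x. uea_gen x \<otimes> 1 + 1 \<otimes> uea_gen x)"
proof -
  have g: "uea_gen (x + y) = uea_gen x + uea_gen y" "uea_gen (c *\<^sub>C x) = c *\<^sub>C uea_gen x"
    "uea_gen (lie_bracket x y) = uea_gen x * uea_gen y - uea_gen y * uea_gen x" for x y :: 'a and c
    using lie_hom_uea_gen by (auto simp: lie_hom_def clinear_iff)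
  have l: "clinear (\<lambda>x. x \<otimes> b)" "clinear ((\<otimes>) b)" for b :: "'a uea"
    using cbilinear_pure_tensor unfolding cbilinear_def by blast+
  have d: "(a - a') \<otimes> b = a \<otimes> b - a' \<otimes> b" "b \<otimes> (a - a') = b \<otimes> a - b \<otimes> a'" for a a' b :: "'a uea"
    by (rule clinear_diff[OF l(1)], rule clinear_diff[OF l(2)])
  show ?thesis
    unfolding lie_hom_def
    by (intro conjI allI clinearI)
      (simp_all add: g d pure_tensor_simps distrib_left distrib_right tensor_mult_pure
        scaleC_add_right)
qed

text \<open>
  The triple tensor product is bracketed to the left. The maps below are
  $A \mapsto A^{12,3}$, $A^{1,23}$, $A^{12}$, $A^{23}$, $(\varepsilon \otimes \mathrm{id})(A)$ and
  $(\mathrm{id} \otimes \varepsilon)(A)$.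
\<close>

type_synonym 'g uea2 = "('g uea, 'g uea) tensor"
type_synonym 'g uea3 = "(('g uea, 'g uea) tensor, 'g uea) tensor"

definition leg_12_3 :: "'g::lie_algebra uea2 \<Rightarrow> 'g uea3" where
  "leg_12_3 = tensor_map comult id"

definition leg_1_23 :: "'g::lie_algebra uea2 \<Rightarrow> 'g uea3" where
  "leg_1_23 A = tensor_assoc (tensor_map id comult A)"

definition leg_12 :: "'g::lie_algebra uea2 \<Rightarrow> 'g uea3" where
  "leg_12 A = A \<otimes> 1"

definition leg_23 :: "'g::lie_algebra uea2 \<Rightarrow> 'g uea3" where
  "leg_23 A = tensor_assoc (1 \<otimes> A)"

definition counit_left :: "'g::lie_algebra uea2 \<Rightarrow> 'g uea" where
  "counit_left = tensor_lift (\<lambda>a b. counit a *\<^sub>C b)"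

definition counit_right :: "'g::lie_algebra uea2 \<Rightarrow> 'g uea" where
  "counit_right = tensor_lift (\<lambda>a b. counit b *\<^sub>C a)"

lemma clinear_comult: "clinear comult" and clinear_counit: "clinear counit"
  by (simp_all add: comult_def counit_def clinear_uea_lift lie_hom_comult lie_hom_zero)

lemma clinear_id: "clinear id"
  by (rule clinearI) auto

lemma leg_12_3_pure: "leg_12_3 (a \<otimes> b) = comult a \<otimes> b"
  by (simp add: leg_12_3_def tensor_map_pure clinear_comult clinear_id)

lemma leg_1_23_pure: "leg_1_23 (a \<otimes> b) = tensor_assoc (a \<otimes> comult b)"
  by (simp add: leg_1_23_def tensor_map_pure clinear_comult clinear_id)

lemma counit_left_pure: "counit_left (a \<otimes> b) = counit a *\<^sub>C b"
  unfolding counit_left_def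
  by (rule tensor_lift_pure, rule cbilinearI)
    (simp_all add: clinear_add[OF clinear_counit] clinear_scale[OF clinear_counit]
      scaleC_add_left scaleC_add_right scaleC_scaleC scaleC_complex_def mult.commute)

lemma counit_right_pure: "counit_right (a \<otimes> b) = counit b *\<^sub>C a"
  unfolding counit_right_def
  by (rule tensor_lift_pure, rule cbilinearI)
    (simp_all add: clinear_add[OF clinear_counit] clinear_scale[OF clinear_counit]
      scaleC_add_left scaleC_add_right scaleC_scaleC scaleC_complex_def mult.commute)

text \<open>
  For a Lie subalgebra \<^term>\<open>S\<close>, \<^term>\<open>uea_sub S\<close> is the image of its enveloping algebra in that of
  the ambient Lie algebra, identified as usual with the enveloping algebra of \<^term>\<open>S\<close>.
  Its Hopf structure is the restriction of the ambient one.
\<close>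

definition uea_sub :: "'g::lie_algebra set \<Rightarrow> 'g uea set" where
  "uea_sub S = cvec.span {prod_list (map uea_gen xs) |xs. set xs \<subseteq> S}"

definition uea_left_ideal :: "'g::lie_algebra set \<Rightarrow> 'g uea set" where
  "uea_left_ideal S = cvec.span {u * uea_gen x |u x. x \<in> S}"

definition invariants :: "'g::lie_algebra set \<Rightarrow> 'g uea2 set" where
  "invariants S = {t. \<forall>x\<in>S. comult (uea_gen x) * t - t * comult (uea_gen x) = 0}"


section \<open>Meromorphic functions on the dual space\<close>

text \<open>
  The dual space of a subspace \<^term>\<open>S\<close> consists of the linear functionals on \<^term>\<open>S\<close>, extended by 0
  outside \<^term>\<open>S\<close> so that each is represented by exactly one function. For finite-dimensional
  \<^term>\<open>S\<close> its usual topology is the one induced by pointwise convergence, which is the topology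
  carried by the function type.
\<close>

definition dual_space :: "'a::complex_vector set \<Rightarrow> ('a \<Rightarrow> complex) set" where
  "dual_space S = {l. (\<forall>x\<in>S. \<forall>y\<in>S. l (x + y) = l x + l y) \<and>
                      (\<forall>c. \<forall>x\<in>S. l (c *\<^sub>C x) = c * l x) \<and> (\<forall>x. x \<notin> S \<longrightarrow> l x = 0)}"

abbreviation open_dual :: "'a::complex_vector set \<Rightarrow> ('a \<Rightarrow> complex) set \<Rightarrow> bool" where
  "open_dual S \<equiv> openin (top_of_set (dual_space S))"

definition holomorphic_dual ::
    "'a::complex_vector set \<Rightarrow> ('a \<Rightarrow> complex) set \<Rightarrow> (('a \<Rightarrow> complex) \<Rightarrow> complex) \<Rightarrow> bool" where
  "holomorphic_dual S U f \<longleftrightarrow> continuous_on U f \<and>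
     (\<forall>l\<in>U. \<forall>m\<in>dual_space S. (\<lambda>z. f (\<lambda>x. l x + z * m x)) field_differentiable at 0)"

text \<open>
  Values in an infinite-dimensional space without topology: holomorphic means taking values in
  some finite-dimensional subspace, with holomorphic coordinates. It is only used locally.
\<close>

definition vholomorphic_dual :: "'a::complex_vector set \<Rightarrow> ('a \<Rightarrow> complex) set \<Rightarrow>
    (('a \<Rightarrow> complex) \<Rightarrow> 'w::complex_vector) \<Rightarrow> bool" where
  "vholomorphic_dual S U f \<longleftrightarrow>
     (\<exists>W g. finite W \<and> (\<forall>w\<in>W. holomorphic_dual S U (g w)) \<and>
            (\<forall>l\<in>U. f l = (\<Sum>w\<in>W. g w l *\<^sub>C w)))"

text \<open>
  Locally a quotient of holomorphic functions, with a denominator that does not vanish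
  identically on any nonempty open set. As for meromorphic functions of one variable, the
  function is total and its values on the zero set of the denominator are arbitrary.
\<close>

definition meromorphic_dual ::
    "'a::complex_vector set \<Rightarrow> (('a \<Rightarrow> complex) \<Rightarrow> 'w::complex_vector) \<Rightarrow> bool" where
  "meromorphic_dual S f \<longleftrightarrow> (\<forall>l\<in>dual_space S. \<exists>U q p. open_dual S U \<and> l \<in> U \<and>
     holomorphic_dual S U q \<and> vholomorphic_dual S U p \<and>
     (\<forall>V. open_dual S V \<and> V \<noteq> {} \<and> V \<subseteq> U \<longrightarrow> (\<exists>m\<in>V. q m \<noteq> 0)) \<and>
     (\<forall>m\<in>U. q m \<noteq> 0 \<longrightarrow> f m = (1 / q m) *\<^sub>C p m))"

definition regular_at ::
    "'a::complex_vector set \<Rightarrow> (('a \<Rightarrow> complex) \<Rightarrow> 'w::complex_vector) \<Rightarrow> ('a \<Rightarrow> complex) \<Rightarrow> bool" where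
  "regular_at S f l \<longleftrightarrow> (\<exists>U. open_dual S U \<and> l \<in> U \<and> vholomorphic_dual S U f)"

text \<open>
  Partial derivative with respect to the coordinate dual to the basis vector \<^term>\<open>b\<close> of
  the span of \<^term>\<open>B\<close>, i.e.\ in the direction of the functional
  \<^term>\<open>\<lambda>x. cvec.representation B x b\<close> of the dual basis. Linear functionals separate points, so the
  value is unique.
\<close>

definition partial_dual :: "'a::complex_vector set \<Rightarrow> 'a \<Rightarrow> (('a \<Rightarrow> complex) \<Rightarrow> 'w::complex_vector)
    \<Rightarrow> ('a \<Rightarrow> complex) \<Rightarrow> 'w" where
  "partial_dual B b f l = (THE w. \<forall>\<phi> :: 'w \<Rightarrow> complex. clinear \<phi> \<longrightarrow>
     ((\<lambda>z. \<phi> (f (\<lambda>x. l x + z * cvec.representation B x b))) has_field_derivative \<phi> w) (at 0))"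

fun partials_dual :: "'a::complex_vector set \<Rightarrow> 'a list \<Rightarrow> (('a \<Rightarrow> complex) \<Rightarrow> 'w::complex_vector)
    \<Rightarrow> ('a \<Rightarrow> complex) \<Rightarrow> 'w" where
  "partials_dual B [] f = f"
| "partials_dual B (b # bs) f = partial_dual B b (partials_dual B bs f)"

lemma partial_dual_eqI:
  fixes f :: "('a::complex_vector \<Rightarrow> complex) \<Rightarrow> 'w::complex_vector"
  assumes "\<And>\<phi> :: 'w \<Rightarrow> complex. clinear \<phi> \<Longrightarrow>
     ((\<lambda>z. \<phi> (f (\<lambda>x. l x + z * cvec.representation B x b))) has_field_derivative \<phi> w) (at 0)"
  shows "partial_dual B b f l = w"
  unfolding partial_dual_def
proof (rule the_equality)
  fix w'
  assume w': "\<forall>\<phi> :: 'w \<Rightarrow> complex. clinear \<phi> \<longrightarrow>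
     ((\<lambda>z. \<phi> (f (\<lambda>x. l x + z * cvec.representation B x b))) has_field_derivative \<phi> w') (at 0)"
  show "w' = w"
  proof (rule ccontr)
    assume "w' \<noteq> w"
    then obtain \<phi> :: "'w \<Rightarrow> complex" where \<phi>: "clinear \<phi>" "\<phi> (w' - w) = 1"
      using ex_functional[of "w' - w"] by auto
    have "\<phi> w' = \<phi> w"
      using w' assms[OF \<phi>(1)] \<phi>(1) DERIV_unique by blast
    then show False
      using \<phi>(2) by (simp add: clinear_diff[OF \<phi>(1)])
  qed
qed (use assms in blast)


section \<open>Quantum twists and quantum dynamical twists\<close>

text \<open>\<^term>\<open>fps_over V\<close> is $V[[\hbar]]$.\<close>

definition fps_over :: "'a::zero set \<Rightarrow> 'a fps set" where
  "fps_over V = {F. \<forall>n. fps_nth F n \<in> V}"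

definition fps_apply :: "('a \<Rightarrow> 'b) \<Rightarrow> 'a fps \<Rightarrow> 'b fps" where
  "fps_apply f F = Abs_fps (\<lambda>n. f (fps_nth F n))"

definition Dom :: "'g::lie_algebra set \<Rightarrow> (('g \<Rightarrow> complex) \<Rightarrow> 'g uea2 fps) \<Rightarrow> ('g \<Rightarrow> complex) set" where
  "Dom \<hh> J = {l \<in> dual_space \<hh>. \<forall>n. regular_at \<hh> (\<lambda>l. fps_nth (J l) n) l}"

text \<open>
  $J(\lambda - \hbar h^{(3)})^{12} = \sum_k \frac{(-\hbar)^k}{k!} \sum_{i_1, \dots, i_k}
  \partial_{i_1} \cdots \partial_{i_k} J(\lambda) \otimes h_{i_1} \cdots h_{i_k}$,
  where $(h_i)$ runs through the basis \<^term>\<open>B\<close>.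
\<close>

definition dynamical_shift ::
    "'g::lie_algebra set \<Rightarrow> (('g \<Rightarrow> complex) \<Rightarrow> 'g uea2 fps) \<Rightarrow> ('g \<Rightarrow> complex) \<Rightarrow> 'g uea3 fps" where
  "dynamical_shift B J l = Abs_fps (\<lambda>n. \<Sum>k\<le>n. ((- 1) ^ k / fact k) *\<^sub>C
     (\<Sum>bs | set bs \<subseteq> B \<and> length bs = k.
        partials_dual B bs (\<lambda>l. fps_nth (J l) (n - k)) l \<otimes> prod_list (map uea_gen bs)))"

definition quantum_dynamical_twist ::
    "'g::lie_algebra set \<Rightarrow> 'g set \<Rightarrow> (('g \<Rightarrow> complex) \<Rightarrow> 'g uea2 fps) \<Rightarrow> bool" where
  "quantum_dynamical_twist \<hh> B J \<longleftrightarrow>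
     (\<forall>n. meromorphic_dual \<hh> (\<lambda>l. fps_nth (J l) n)) \<and>
     (\<forall>l\<in>Dom \<hh> J.
        J l \<in> fps_over (invariants \<hh>) \<and>
        fps_apply leg_12_3 (J l) * dynamical_shift B J l
          = fps_apply leg_1_23 (J l) * fps_apply leg_23 (J l) \<and>
        fps_apply counit_left (J l) = 1 \<and> fps_apply counit_right (J l) = 1)"

definition quantum_twist :: "'g::lie_algebra uea set \<Rightarrow> 'g uea2 fps \<Rightarrow> bool" where
  "quantum_twist A K \<longleftrightarrow> K \<in> fps_over (tensor_sub A A) \<and>
     fps_apply leg_12_3 K * fps_apply leg_12 K = fps_apply leg_1_23 K * fps_apply leg_23 K \<and>
     fps_apply counit_left K = 1 \<and> fps_apply counit_right K = 1"

definition twist_projection :: "'g::lie_algebra set \<Rightarrow> 'g set \<Rightarrow> 'g uea2 fps \<Rightarrow> 'g uea2 fps" where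
  "twist_projection \<hh> \<vv> = proj_along
     (fps_over (tensor_sub (uea_sub \<vv>) (uea_sub \<vv>)))
     (fps_over {s + t |s t. s \<in> tensor_sub (uea_left_ideal \<hh>) UNIV \<and>
                            t \<in> tensor_sub UNIV (uea_left_ideal \<hh>)})"

end

theory Submission
  imports Defs
begin

text \<open>
  Write $I = U\mathfrak g \cdot \mathfrak h$. Commuting elements of $\mathfrak h$ to the right gives
  $U\mathfrak g = U\mathfrak v + I$. For $U\mathfrak v \cap I = 0$ the
  Poincare-Birkhoff-Witt theorem is not needed: left multiplication by $\mathfrak v$ on $U\mathfrak v$
  extends to an action of $\mathfrak g$ in which $\mathfrak h$ kills $1$, so acting on $1$ annihilates
  $I$ and recovers each element of $U\mathfrak v$.

  Let $P$ be the projection onto $U\mathfrak v$ along $I$; then $J_{\mathfrak v} = (P \otimes P)(J)$.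
  Apply $P \otimes P \otimes P$ to the dynamical equation. The terms of positive order in the shift
  end in an element of $I$ in the third leg and vanish. Since $J$ is invariant,
  $\Delta(uh) J = \Delta(u) J \Delta(h)$ is killed by $P \otimes P$ for $h \in \mathfrak h$, whence
  $(P \otimes P)(\Delta(a) J) = \Delta(P a) (P \otimes P)(J)$, and both sides become those of the
  equation for $J_{\mathfrak v}$.
\<close>


section \<open>Linear maps\<close>

lemma clinear_ident: "clinear (\<lambda>x. x)"
  by (rule clinearI) simp_all

lemma clinear_fun_add: "clinear f \<Longrightarrow> clinear g \<Longrightarrow> clinear (\<lambda>x. f x + g x)"
  by (simp add: clinear_iff scaleC_add_right)

lemma clinear_fun_diff: "clinear f \<Longrightarrow> clinear g \<Longrightarrow> clinear (\<lambda>x. f x - g x)"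
  by (simp add: clinear_iff cvec.scale_right_diff_distrib)

lemma clinear_fun_scaleC: "clinear f \<Longrightarrow> clinear (\<lambda>x. c *\<^sub>C f x)"
  by (simp add: clinear_iff scaleC_add_right scaleC_scaleC mult.commute)

lemma clinear_fun_mult_left: "clinear f \<Longrightarrow> clinear (\<lambda>x. a * f x)"
  for f :: "_ \<Rightarrow> 'a::complex_algebra_1"
  by (simp add: clinear_iff distrib_left mult_scaleC_right)

lemma clinear_fun_mult_right: "clinear f \<Longrightarrow> clinear (\<lambda>x. f x * a)"
  for f :: "_ \<Rightarrow> 'a::complex_algebra_1"
  by (simp add: clinear_iff distrib_right mult_scaleC_left)

lemmas clinear_intros = clinear_ident clinear_fun_add clinear_fun_diff clinear_fun_scaleC
  clinear_fun_mult_left clinear_fun_mult_right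


section \<open>Projections along a complement\<close>

lemma proj_along_eqI:
  assumes "cvec.subspace A" "cvec.subspace B" "A \<inter> B = {0}" "a \<in> A" "x - a \<in> B"
  shows "proj_along A B x = a"
  unfolding proj_along_def
proof (rule the_equality)
  fix a' assume a': "a' \<in> A \<and> x - a' \<in> B"
  have "a' - a \<in> A"
    using assms a' by (auto intro: cvec.subspace_diff)
  moreover have "(x - a) - (x - a') \<in> B"
    using assms a' by (blast intro: cvec.subspace_diff)
  ultimately have "a' - a \<in> A \<inter> B"
    by simp
  then show "a' = a"
    using assms(3) by auto
qed (use assms in auto)

context
  fixes A B :: "'a::complex_vector set"
  assumes A: "cvec.subspace A" and B: "cvec.subspace B" and AB: "direct_sum A B UNIV"
begin

lemma proj_along_in: "proj_along A B x \<in> A"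
  and minus_proj_along_in: "x - proj_along A B x \<in> B"
proof -
  have "x \<in> {a + b |a b. a \<in> A \<and> b \<in> B}"
    using AB by (simp add: direct_sum_def)
  then obtain a b where ab: "x = a + b" "a \<in> A" "b \<in> B"
    by blast
  then have "proj_along A B x = a"
    using AB by (intro proj_along_eqI[OF A B]) (auto simp: direct_sum_def)
  then show "proj_along A B x \<in> A" "x - proj_along A B x \<in> B"
    using ab by auto
qed

lemma proj_alongI: "a \<in> A \<Longrightarrow> x - a \<in> B \<Longrightarrow> proj_along A B x = a"
  using AB by (intro proj_along_eqI[OF A B]) (auto simp: direct_sum_def)

lemma proj_along_id: "x \<in> A \<Longrightarrow> proj_along A B x = x"
  using cvec.subspace_0[OF B] by (intro proj_alongI) auto

lemma proj_along_zero: "x \<in> B \<Longrightarrow> proj_along A B x = 0"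
  using cvec.subspace_0[OF A] by (intro proj_alongI) auto

lemma clinear_proj_along: "clinear (proj_along A B)"
proof (rule clinearI)
  fix x y c
  show "proj_along A B (x + y) = proj_along A B x + proj_along A B y"
  proof (rule proj_alongI)
    have "(x - proj_along A B x) + (y - proj_along A B y) \<in> B"
      by (intro cvec.subspace_add[OF B] minus_proj_along_in)
    then show "x + y - (proj_along A B x + proj_along A B y) \<in> B"
      by (simp add: algebra_simps)
  qed (intro cvec.subspace_add[OF A] proj_along_in)
  show "proj_along A B (c *\<^sub>C x) = c *\<^sub>C proj_along A B x"
  proof (rule proj_alongI)
    have "c *\<^sub>C (x - proj_along A B x) \<in> B"
      by (intro cvec.subspace_scale[OF B] minus_proj_along_in)
    then show "c *\<^sub>C x - c *\<^sub>C proj_along A B x \<in> B"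
      by (simp add: cvec.scale_right_diff_distrib)
  qed (intro cvec.subspace_scale[OF A] proj_along_in)
qed

end


section \<open>Linear maps on tensor products\<close>

lemma clinear_tensor_map: "clinear f \<Longrightarrow> clinear g \<Longrightarrow> clinear (tensor_map f g)"
  unfolding tensor_map_def by (intro clinear_tensor_lift cbilinear_tensor_map)

text \<open>A tensor is represented by a finite combination of pairs, so \<open>F t\<close> is a
  finite combination of the values of \<open>F\<close> on pure tensors.\<close>

lemma clinear_image_tensor_subspace:
  assumes "cvec.subspace S" "clinear F" "\<And>a b. F (a \<otimes> b) \<in> S"
  shows "F t \<in> S"
proof -
  note b = cbilinear_compose[OF cbilinear_pure_tensor assms(2)]
  obtain p where p: "t = abs_tensor p"
    by (metis Quotient3_abs_rep[OF Quotient3_tensor])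
  have "F t = tensor_lift (\<lambda>a b. F (a \<otimes> b)) t"
    by (rule clinear_eq_on_pure[OF assms(2) clinear_tensor_lift[OF b]])
      (simp add: tensor_lift_pure[OF b])
  also have "\<dots> = lin_ext (\<lambda>(a, b). F (a \<otimes> b)) p"
    by (simp add: p tensor_lift_abs[OF b])
  also have "\<dots> \<in> S"
    unfolding lin_ext_def using assms(3)
    by (intro cvec.subspace_sum[OF assms(1)] cvec.subspace_scale[OF assms(1)]) auto
  finally show ?thesis .
qed

lemma clinear_tensor_assoc: "clinear tensor_assoc"
  unfolding tensor_assoc_def by (rule clinear_tensor_lift[OF cbilinear_tensor_assoc])

lemma clinear_pure_left: "clinear (\<lambda>a. a \<otimes> b)" and clinear_pure_right: "clinear (\<lambda>b. a \<otimes> b)"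
  using cbilinear_pure_tensor unfolding cbilinear_def by blast+

text \<open>Two rounds of reduction to pure tensors, for the right bracketing on which
  \<open>tensor_assoc\<close> is defined.\<close>

lemma clinear_eq_on_pure_right:
  fixes f g :: "('a::complex_vector, ('b::complex_vector, 'c::complex_vector) tensor) tensor
    \<Rightarrow> 'd::complex_vector"
  assumes "clinear f" "clinear g" "\<And>a b c. f (a \<otimes> (b \<otimes> c)) = g (a \<otimes> (b \<otimes> c))"
  shows "f t = g t"
proof (rule clinear_eq_on_pure[OF assms(1,2)])
  show "f (a \<otimes> s) = g (a \<otimes> s)" for a s
    by (rule clinear_eq_on_pure[OF clinear_compose[OF assms(1) clinear_pure_right]
          clinear_compose[OF assms(2) clinear_pure_right] assms(3)])
qed

text \<open>Naturality of the associator; it later carries the projections across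
  \<open>tensor_assoc\<close>.\<close>

lemma tensor_assoc_tensor_map:
  assumes f: "clinear f" and g: "clinear g" and h: "clinear h"
  shows "tensor_assoc (tensor_map f (tensor_map g h) t) = tensor_map (tensor_map f g) h (tensor_assoc t)"
  by (rule clinear_eq_on_pure_right[OF clinear_compose[OF clinear_tensor_assoc
          clinear_tensor_map[OF f clinear_tensor_map[OF g h]]]
        clinear_compose[OF clinear_tensor_map[OF clinear_tensor_map[OF f g] h] clinear_tensor_assoc]])
    (simp add: tensor_assoc_pure tensor_map_pure clinear_tensor_map f g h)

lemma tensor_assoc_mult: "tensor_assoc (s * t) = tensor_assoc s * tensor_assoc t"
proof -
  have mult: "clinear (\<lambda>x. x * t)" "clinear (\<lambda>x. t * x)" for t :: "'z::complex_algebra_1"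
    by (intro clinear_intros)+
  have 1: "tensor_assoc ((a \<otimes> (b \<otimes> c)) * t) = tensor_assoc (a \<otimes> (b \<otimes> c)) * tensor_assoc t" for a b c
    by (rule clinear_eq_on_pure_right[OF clinear_compose[OF clinear_tensor_assoc mult(2)]
          clinear_compose[OF mult(2) clinear_tensor_assoc]])
      (simp add: tensor_assoc_pure tensor_mult_pure)
  show ?thesis
    by (rule clinear_eq_on_pure_right[OF clinear_compose[OF clinear_tensor_assoc mult(1)]
          clinear_compose[OF mult(1) clinear_tensor_assoc] 1])
qed

lemma comult_mult: "comult (u * v) = comult u * comult v"
  and comult_1: "comult 1 = 1"
  and comult_gen: "comult (uea_gen x) = uea_gen x \<otimes> 1 + 1 \<otimes> uea_gen x"
  by (simp_all add: comult_def uea_lift_mult uea_lift_1 uea_lift_gen lie_hom_comult)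


section \<open>Lie algebras and enveloping algebras\<close>

lemma lie_bracket_antisym: "lie_bracket x y = - lie_bracket y x"
proof -
  have "0 = lie_bracket (x + y) (x + y)"
    by (simp add: lie_bracket_self)
  also have "\<dots> = lie_bracket x y + lie_bracket y x"
    unfolding lie_bracket_add_left lie_bracket_add_right by (simp add: lie_bracket_self)
  finally have "lie_bracket x y + lie_bracket y x = 0"
    by (rule sym)
  then show ?thesis
    by (simp add: eq_neg_iff_add_eq_0 lie_bracket_self)
qed

lemma lie_bracket_minus_right: "lie_bracket x (- y) = - lie_bracket x y"
  using lie_bracket_scale_right[of x "-1" y] by simp

text \<open>The Jacobi identity in the form that the adjoint map is a representation. Nested
  brackets arise in this form when the operators below are commuted.\<close>

lemma lie_jacobi_left:
  "lie_bracket (lie_bracket x y) z = lie_bracket x (lie_bracket y z) - lie_bracket y (lie_bracket x z)"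
proof -
  have "lie_bracket x (lie_bracket y z) - lie_bracket y (lie_bracket x z)
      - lie_bracket (lie_bracket x y) z = 0"
    using lie_jacobi[of x y z] lie_bracket_antisym[of z x] lie_bracket_antisym[of z "lie_bracket x y"]
    by (simp add: lie_bracket_minus_right)
  then show ?thesis
    by simp
qed

abbreviation letter :: "'g \<Rightarrow> 'g list \<Rightarrow>\<^sub>0 complex" where
  "letter x \<equiv> Poly_Mapping.single [x] 1"

lemma single_Cons: "Poly_Mapping.single (x # w) (1::complex) = letter x * Poly_Mapping.single w 1"
  by (simp add: mult_single plus_list_def)

lemma abs_uea_surj: "\<exists>p. u = abs_uea p"
  by (metis Quotient3_abs_rep[OF Quotient3_uea])

lemma prod_list_uea_gen: "prod_list (map uea_gen w) = abs_uea (Poly_Mapping.single w 1)"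
proof (induction w)
  case Nil
  show ?case
    by (metis one_uea_def single_one zero_list_def list.map(1) prod_list.Nil)
next
  case (Cons x w)
  then show ?case
    by (simp add: uea_gen.abs_eq times_uea.abs_eq mult_single plus_list_def)
qed

lemma subspace_uea_sub: "cvec.subspace (uea_sub S)"
  and subspace_uea_left_ideal: "cvec.subspace (uea_left_ideal S)"
  by (simp_all add: uea_sub_def uea_left_ideal_def cvec.subspace_span)

lemma uea_sub_prod: "set w \<subseteq> S \<Longrightarrow> prod_list (map uea_gen w) \<in> uea_sub S"
  unfolding uea_sub_def by (rule cvec.span_base) blast

lemma uea_sub_1: "1 \<in> uea_sub S"
  using uea_sub_prod[of "[]"] by simp

lemma uea_sub_gen: "x \<in> S \<Longrightarrow> uea_gen x \<in> uea_sub S"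
  using uea_sub_prod[of "[x]"] by simp

lemma uea_sub_mult:
  assumes "u \<in> uea_sub S" "v \<in> uea_sub S"
  shows "u * v \<in> uea_sub S"
  using assms(1) unfolding uea_sub_def[of S]
proof (induction rule: cvec.span_induct_alt)
  case base
  show ?case
    using cvec.subspace_0[OF subspace_uea_sub] by (simp add: uea_sub_def)
next
  case (step c x y)
  then obtain w where w: "set w \<subseteq> S" "x = prod_list (map uea_gen w)"
    by blast
  have "x * v \<in> uea_sub S"
    using assms(2) unfolding uea_sub_def[of S]
  proof (induction rule: cvec.span_induct_alt)
    case base
    show ?case
      using cvec.subspace_0[OF subspace_uea_sub] by (simp add: uea_sub_def)
  next
    case (step d a b)
    then obtain w' where w': "set w' \<subseteq> S" "a = prod_list (map uea_gen w')"
      by blast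
    have "x * a \<in> uea_sub S"
      using uea_sub_prod[of "w @ w'" S] w w' by simp
    then show ?case
      using step.IH cvec.subspace_add[OF subspace_uea_sub, of _ S] cvec.subspace_scale[OF subspace_uea_sub, of _ S]
      by (simp add: uea_sub_def[symmetric] distrib_left mult_scaleC_right)
  qed
  then show ?case
    using step.IH cvec.subspace_add[OF subspace_uea_sub, of _ S] cvec.subspace_scale[OF subspace_uea_sub, of _ S]
    by (simp add: uea_sub_def[symmetric] distrib_right mult_scaleC_left)
qed

lemma uea_left_ideal_gen: "x \<in> S \<Longrightarrow> u * uea_gen x \<in> uea_left_ideal S"
  unfolding uea_left_ideal_def by (rule cvec.span_base) blast

lemma uea_left_ideal_mult:
  assumes "v \<in> uea_left_ideal S"
  shows "u * v \<in> uea_left_ideal S"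
  using assms unfolding uea_left_ideal_def[of S]
proof (induction rule: cvec.span_induct_alt)
  case base
  show ?case
    using cvec.subspace_0[OF subspace_uea_left_ideal] by (simp add: uea_left_ideal_def)
next
  case (step c a b)
  then obtain u' x where x: "x \<in> S" "a = u' * uea_gen x"
    by blast
  have "u * a \<in> uea_left_ideal S"
    using uea_left_ideal_gen[OF x(1), of "u * u'"] by (simp add: x(2) mult.assoc)
  then show ?case
    using step.IH cvec.subspace_add[OF subspace_uea_left_ideal, of _ S]
      cvec.subspace_scale[OF subspace_uea_left_ideal, of _ S]
    by (simp add: uea_left_ideal_def[symmetric] distrib_left mult_scaleC_right)
qed

lemma uea_gen_simps: "uea_gen (x + y) = uea_gen x + uea_gen y"
  "uea_gen (lie_bracket x y) = uea_gen x * uea_gen y - uea_gen y * uea_gen x"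
  using lie_hom_uea_gen by (auto simp: lie_hom_def clinear_iff)

lemma fps_nth_apply: "fps_nth (fps_apply f F) n = f (fps_nth F n)"
  by (simp add: fps_apply_def)


section \<open>The module induced from the trivial representation\<close>

locale lie_complement =
  fixes \<hh> \<vv> :: "'g::lie_algebra set"
  assumes lie_hh: "lie_subalgebra \<hh>" and lie_vv: "lie_subalgebra \<vv>"
    and direct_sum: "direct_sum \<hh> \<vv> UNIV"
begin

section \<open>The two components of an element of the Lie algebra\<close>

lemma subspace_hh: "cvec.subspace \<hh>" and subspace_vv: "cvec.subspace \<vv>"
  using lie_hh lie_vv by (auto simp: lie_subalgebra_def)

definition ph :: "'g \<Rightarrow> 'g" where "ph = proj_along \<hh> \<vv>"
definition pv :: "'g \<Rightarrow> 'g" where "pv x = x - ph x"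

lemma ph_in: "ph x \<in> \<hh>" and pv_in: "pv x \<in> \<vv>" and ph_id: "x \<in> \<hh> \<Longrightarrow> ph x = x"
  and pv_id: "x \<in> \<vv> \<Longrightarrow> pv x = x" and ph_zero: "x \<in> \<vv> \<Longrightarrow> ph x = 0"
  and pv_zero: "x \<in> \<hh> \<Longrightarrow> pv x = 0" and ph_pv: "ph x + pv x = x"
  and clinear_ph: "clinear ph"
  unfolding ph_def pv_def
  by (simp_all add: proj_along_in[OF subspace_hh subspace_vv direct_sum]
      minus_proj_along_in[OF subspace_hh subspace_vv direct_sum]
      proj_along_id[OF subspace_hh subspace_vv direct_sum]
      proj_along_zero[OF subspace_hh subspace_vv direct_sum]
      clinear_proj_along[OF subspace_hh subspace_vv direct_sum])

lemma clinear_pv: "clinear pv"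
  by (rule clinearI) (simp_all add: pv_def clinear_add[OF clinear_ph] clinear_scale[OF clinear_ph]
      cvec.scale_right_diff_distrib)

lemma bracket_hh: "x \<in> \<hh> \<Longrightarrow> y \<in> \<hh> \<Longrightarrow> lie_bracket x y \<in> \<hh>"
  and bracket_vv: "x \<in> \<vv> \<Longrightarrow> y \<in> \<vv> \<Longrightarrow> lie_bracket x y \<in> \<vv>"
  using lie_hh lie_vv by (auto simp: lie_subalgebra_def)

text \<open>
  The kernel of the map from the free algebra on all of \<^typ>\<open>'g\<close> that imposes the enveloping algebra
  relations among letters from \<^term>\<open>\<vv>\<close> only. Working modulo it stands in for the quotient, which
  cannot be a type because it depends on \<^term>\<open>\<vv>\<close>.
\<close>

inductive_set rel :: "('g list \<Rightarrow>\<^sub>0 complex) set" where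
  gen_add: "x \<in> \<vv> \<Longrightarrow> y \<in> \<vv> \<Longrightarrow> letter (x + y) * b - letter x * b - letter y * b \<in> rel"
| gen_scale: "x \<in> \<vv> \<Longrightarrow> letter (c *\<^sub>C x) * b - c *\<^sub>C (letter x * b) \<in> rel"
| gen_bracket: "x \<in> \<vv> \<Longrightarrow> y \<in> \<vv> \<Longrightarrow>
    letter x * (letter y * b) - letter y * (letter x * b) - letter (lie_bracket x y) * b \<in> rel"
| zero: "0 \<in> rel"
| add: "p \<in> rel \<Longrightarrow> q \<in> rel \<Longrightarrow> p + q \<in> rel"
| left: "p \<in> rel \<Longrightarrow> letter y * p \<in> rel"

text \<open>The generators carry a free right factor \<open>b\<close>, which absorbs the
  scalar.\<close>

lemma rel_scale: "p \<in> rel \<Longrightarrow> c *\<^sub>C p \<in> rel"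
proof (induction rule: rel.induct)
  case (gen_add x y b)
  then show ?case using rel.gen_add[of x y "c *\<^sub>C b"]
    by (simp add: cvec.scale_right_diff_distrib mult_scaleC_right)
next
  case (gen_scale x d b)
  then show ?case using rel.gen_scale[of x d "c *\<^sub>C b"]
    by (simp add: cvec.scale_right_diff_distrib mult_scaleC_right scaleC_scaleC mult.commute)
next
  case (gen_bracket x y b)
  then show ?case using rel.gen_bracket[of x y "c *\<^sub>C b"]
    by (simp add: cvec.scale_right_diff_distrib mult_scaleC_right)
next
  case (add p q)
  then show ?case by (simp add: scaleC_add_right rel.add)
next
  case (left p y)
  then show ?case using rel.left[of "c *\<^sub>C p" y] by (simp add: mult_scaleC_right)
qed (simp add: cvec.scale_zero_right rel.zero)

lemma rel_uminus: "p \<in> rel \<Longrightarrow> - p \<in> rel"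
  using rel_scale[of p "-1"] by simp

lemma rel_diff: "p \<in> rel \<Longrightarrow> q \<in> rel \<Longrightarrow> p - q \<in> rel"
  using rel.add[OF _ rel_uminus, of p q] by simp

lemma rel_sum: "(\<And>i. i \<in> S \<Longrightarrow> f i \<in> rel) \<Longrightarrow> sum f S \<in> rel"
  by (induction S rule: infinite_finite_induct) (auto intro: rel.zero rel.add)

text \<open>Turns a conclusion modulo \<open>rel\<close> back into an equality in the enveloping
  algebra.\<close>

lemma rel_subset_uea_ideal: "p \<in> rel \<Longrightarrow> p \<in> uea_ideal"
proof (induction rule: rel.induct)
  case (gen_add x y b)
  show ?case using uea_ideal_mult_right[OF uea_ideal.gen_add[of x y], of b]
    by (simp add: algebra_simps)
next
  case (gen_scale x c b)
  show ?case using uea_ideal_mult_right[OF uea_ideal.gen_scale[of c x], of b]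
    by (simp add: algebra_simps mult_scaleC_left)
next
  case (gen_bracket x y b)
  show ?case using uea_ideal_mult_right[OF uea_ideal.gen_bracket[of x y], of b]
    by (simp add: algebra_simps)
qed (auto intro: uea_ideal.zero uea_ideal.add uea_ideal_mult_left)

text \<open>
  The action of \<^term>\<open>x \<in> \<hh>\<close> on a word: it kills the empty word, and the recursion moves
  \<^term>\<open>x\<close> past the first letter \<^term>\<open>y\<close> at the cost of the two components of \<^term>\<open>lie_bracket x y\<close>.
\<close>

primrec word_act :: "'g list \<Rightarrow> 'g \<Rightarrow> 'g list \<Rightarrow>\<^sub>0 complex" where
  "word_act [] x = 0"
| "word_act (y # w) x = letter y * word_act w x
     + letter (pv (lie_bracket x y)) * Poly_Mapping.single w 1 + word_act w (ph (lie_bracket x y))"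

text \<open>Exactly linear in the free algebra argument only: in \<open>x\<close> linearity holds
  modulo \<open>rel\<close>, because \<open>letter\<close> is not additive on the nose.\<close>

definition act :: "'g \<Rightarrow> ('g list \<Rightarrow>\<^sub>0 complex) \<Rightarrow> 'g list \<Rightarrow>\<^sub>0 complex" where
  "act x = lin_ext (\<lambda>w. word_act w x)"

text \<open>Elements of \<open>\<vv>\<close> act by left multiplication, those of
  \<open>\<hh>\<close> by \<open>act\<close>. Modulo \<open>rel\<close> this becomes a
  representation of the whole Lie algebra, and the submodule generated by 1 is the module induced
  from the trivial representation of \<open>\<hh>\<close>.\<close>

definition rho :: "'g \<Rightarrow> ('g list \<Rightarrow>\<^sub>0 complex) \<Rightarrow> 'g list \<Rightarrow>\<^sub>0 complex" where
  "rho x p = letter (pv x) * p + act (ph x) p"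

section \<open>The operators on the free algebra and their exact commutation with letters\<close>

lemma clinear_act: "clinear (act x)"
  by (simp add: act_def clinear_lin_ext)

lemmas act_simps = clinear_add[OF clinear_act] clinear_diff[OF clinear_act]
  clinear_scale[OF clinear_act] clinear_0[OF clinear_act]

lemmas clinear_fun_act = clinear_compose[OF clinear_act]

lemma clinear_rho: "clinear (rho x)"
  unfolding rho_def by (intro clinear_intros clinear_fun_act)

lemmas clinear_fun_rho = clinear_compose[OF clinear_rho]

lemma act_1: "act x 1 = 0"
  by (simp add: act_def lin_ext_single flip: single_one) (simp add: zero_list_def)

lemma act_single: "act x (Poly_Mapping.single w 1) = word_act w x"
  by (simp add: act_def lin_ext_single scaleC_one)

text \<open>The last two summands in the recursion of \<open>word_act\<close> are
  \<open>rho (lie_bracket x y)\<close> applied to the rest of the word. Hence this rule is an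
  equality in the free algebra, for every letter \<open>y\<close>, and not only a congruence modulo
  \<open>rel\<close>.\<close>

lemma act_letter: "act x (letter y * p) = letter y * act x p + rho (lie_bracket x y) p"
proof (rule clinear_eq_on_singles[where f = "\<lambda>p. act x (letter y * p)"
      and g = "\<lambda>p. letter y * act x p + rho (lie_bracket x y) p"])
  show "clinear (\<lambda>p. act x (letter y * p))"
    "clinear (\<lambda>p. letter y * act x p + rho (lie_bracket x y) p)"
    by (intro clinear_intros clinear_fun_act clinear_fun_rho)+
  show "act x (letter y * Poly_Mapping.single k 1)
      = letter y * act x (Poly_Mapping.single k 1) + rho (lie_bracket x y) (Poly_Mapping.single k 1)" for k
    by (simp add: act_single rho_def flip: single_Cons)
qed

lemma rel_on_words:
  fixes F :: "('k \<Rightarrow>\<^sub>0 complex) \<Rightarrow> 'g list \<Rightarrow>\<^sub>0 complex"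
  assumes "clinear F" "\<And>w. F (Poly_Mapping.single w 1) \<in> rel"
  shows "F p \<in> rel"
proof -
  have "F (Poly_Mapping.single w c) \<in> rel" for w c
    using rel_scale[OF assms(2)[of w], of c]
    by (simp add: clinear_scale[OF assms(1), symmetric] scaleC_single scaleC_complex_def)
  then have "F (\<Sum>w\<in>Poly_Mapping.keys p. Poly_Mapping.single w (Poly_Mapping.lookup p w)) \<in> rel"
    by (simp only: clinear_sum[OF assms(1)] rel_sum)
  then show ?thesis
    by (simp only: poly_mapping_sum_single[symmetric])
qed

section \<open>Linearity in the acting element modulo \<open>rel\<close>\<close>

lemma letter_pv_linear: "letter (pv (x + y)) * b - letter (pv x) * b - letter (pv y) * b \<in> rel"
  "letter (pv (c *\<^sub>C x)) * b - c *\<^sub>C (letter (pv x) * b) \<in> rel"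
  by (simp_all add: clinear_add[OF clinear_pv] clinear_scale[OF clinear_pv] rel.gen_add rel.gen_scale
      pv_in)

text \<open>Induction on the word. The acting elements are generalised because the recursion
  replaces them by the \<open>\<hh>\<close> components of their brackets with the first
  letter.\<close>

lemma act_add: "act (x + y) p - act x p - act y p \<in> rel"
proof (rule rel_on_words[where F = "\<lambda>p. act (x + y) p - act x p - act y p"])
  show "clinear (\<lambda>p. act (x + y) p - act x p - act y p)"
    by (intro clinear_intros clinear_fun_act)
  show "act (x + y) (Poly_Mapping.single w 1) - act x (Poly_Mapping.single w 1)
      - act y (Poly_Mapping.single w 1) \<in> rel" for w
    unfolding act_single
  proof (induction w arbitrary: x y)
    case (Cons z w)
    from rel.add[OF rel.add[OF rel.left[OF Cons[of x y], of z]
        letter_pv_linear(1)[of "lie_bracket x z" "lie_bracket y z" "Poly_Mapping.single w 1"]]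
        Cons[of "ph (lie_bracket x z)" "ph (lie_bracket y z)"]]
    show ?case
      by (simp add: lie_bracket_add_left clinear_add[OF clinear_ph] algebra_simps)
  qed (simp add: rel.zero)
qed

lemma act_scaleC: "act (c *\<^sub>C x) p - c *\<^sub>C act x p \<in> rel"
proof (rule rel_on_words[where F = "\<lambda>p. act (c *\<^sub>C x) p - c *\<^sub>C act x p"])
  show "clinear (\<lambda>p. act (c *\<^sub>C x) p - c *\<^sub>C act x p)"
    by (intro clinear_intros clinear_fun_act)
  show "act (c *\<^sub>C x) (Poly_Mapping.single w 1) - c *\<^sub>C act x (Poly_Mapping.single w 1) \<in> rel" for w
    unfolding act_single
  proof (induction w arbitrary: x)
    case (Cons z w)
    from rel.add[OF rel.add[OF rel.left[OF Cons[of x], of z]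
        letter_pv_linear(2)[of c "lie_bracket x z" "Poly_Mapping.single w 1"]]
        Cons[of "ph (lie_bracket x z)"]]
    show ?case
      by (simp add: lie_bracket_scale_left clinear_scale[OF clinear_ph] algebra_simps
          scaleC_add_right mult_scaleC_right)
  qed (simp add: rel.zero cvec.scale_zero_right)
qed

lemma rho_add: "rho (x + y) p - rho x p - rho y p \<in> rel"
  using rel.add[OF letter_pv_linear(1)[of x y p] act_add[of "ph x" "ph y" p]]
  by (simp add: rho_def clinear_add[OF clinear_ph] algebra_simps)

lemma rho_scaleC: "rho (c *\<^sub>C x) p - c *\<^sub>C rho x p \<in> rel"
  using rel.add[OF letter_pv_linear(2)[of c x p] act_scaleC[of c "ph x" p]]
  by (simp add: rho_def clinear_scale[OF clinear_ph] algebra_simps scaleC_add_right)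

lemma rho_diff: "rho (x - y) p - (rho x p - rho y p) \<in> rel"
  using rel.add[OF rho_add[of x "- y" p] rho_scaleC[of "-1" y p]]
  by (simp add: algebra_simps)

section \<open>Commutation relations modulo \<open>rel\<close>\<close>

lemma rho_vv: "x \<in> \<vv> \<Longrightarrow> rho x p - letter x * p \<in> rel"
  \<comment> \<open>\<open>act 0 p\<close> need not vanish, since the recursion leaves terms with
    the nonzero element \<open>letter 0\<close>. Scaling by 0 shows that it lies in
    \<open>rel\<close>; the same device disposes of \<open>letter 0 * p\<close> in the next
    lemma.\<close>
  using act_scaleC[of 0 0 p] by (simp add: rho_def pv_id ph_zero)

lemma rho_hh: "x \<in> \<hh> \<Longrightarrow> rho x p - act x p \<in> rel"
  using rel.gen_scale[of 0 0 p] cvec.subspace_0[OF subspace_vv]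
  by (simp add: rho_def pv_zero ph_id)

text \<open>For the \<open>\<hh>\<close> component of \<open>x\<close> this is
  \<open>act_letter\<close>. For the \<open>\<vv>\<close> component it is the bracket relation
  between the letters \<open>pv x\<close> and \<open>z\<close>, which \<open>rel\<close> contains
  because both lie in \<open>\<vv>\<close>.\<close>

lemma rho_letter:
  assumes z: "z \<in> \<vv>"
  shows "rho x (letter z * p) - letter z * rho x p - rho (lie_bracket x z) p \<in> rel"
proof -
  let ?h = "lie_bracket (ph x) z" and ?v = "lie_bracket (pv x) z"
  have x: "lie_bracket x z = ?h + ?v"
    by (simp add: ph_pv flip: lie_bracket_add_left)
  note 1 = rel.gen_bracket[OF pv_in[of x] z, of p]
  note 2 = rho_vv[OF bracket_vv[OF pv_in[of x] z], of p]
  note 3 = rho_add[of ?h ?v p]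
  have "rho x (letter z * p) - letter z * rho x p - rho (lie_bracket x z) p =
     (letter (pv x) * (letter z * p) - letter z * (letter (pv x) * p) - letter ?v * p)
     - (rho ?v p - letter ?v * p) - (rho (?h + ?v) p - rho ?h p - rho ?v p)"
    unfolding x by (simp add: rho_def[of x] act_letter algebra_simps)
  also have "\<dots> \<in> rel"
    by (intro rel_diff 1 2 3)
  finally show ?thesis .
qed

text \<open>Pushing \<open>act x\<close> through the letters turns each generator into the same
  generator with \<open>act x b\<close> for \<open>b\<close>, plus a term covered by linearity of
  \<open>rho\<close> or, for brackets, by \<open>rho_letter\<close> and the Jacobi identity. So the
  action descends to the quotient by \<open>rel\<close>.\<close>

lemma act_rel: "p \<in> rel \<Longrightarrow> act x p \<in> rel"
proof (induction arbitrary: x rule: rel.induct)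
  case (gen_add y z b)
  have "act x (letter (y + z) * b - letter y * b - letter z * b) =
     (letter (y + z) * act x b - letter y * act x b - letter z * act x b)
     + (rho (lie_bracket x y + lie_bracket x z) b - rho (lie_bracket x y) b - rho (lie_bracket x z) b)"
    by (simp add: act_simps act_letter lie_bracket_add_right algebra_simps)
  then show ?case
    using rel.add[OF rel.gen_add[OF gen_add, of "act x b"] rho_add] by simp
next
  case (gen_scale y c b)
  have "act x (letter (c *\<^sub>C y) * b - c *\<^sub>C (letter y * b)) =
     (letter (c *\<^sub>C y) * act x b - c *\<^sub>C (letter y * act x b))
     + (rho (c *\<^sub>C lie_bracket x y) b - c *\<^sub>C rho (lie_bracket x y) b)"
    by (simp add: act_simps act_letter lie_bracket_scale_right algebra_simps scaleC_add_right)
  then show ?case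
    using rel.add[OF rel.gen_scale[OF gen_scale, of c "act x b"] rho_scaleC] by simp
next
  case (gen_bracket y z b)
  let ?xy = "lie_bracket x y" and ?xz = "lie_bracket x z" and ?yz = "lie_bracket y z"
  have j: "lie_bracket ?xy z - lie_bracket ?xz y = lie_bracket x ?yz"
    using lie_jacobi_left[of x y z] lie_bracket_antisym[of ?xz y] by simp
  note 1 = rel.gen_bracket[OF gen_bracket, of "act x b"]
  note 2 = rho_letter[OF gen_bracket(2), of ?xy b]
  note 3 = rho_letter[OF gen_bracket(1), of ?xz b]
  note 4 = rho_diff[of "lie_bracket ?xy z" "lie_bracket ?xz y" b, unfolded j]
  have "act x (letter y * (letter z * b) - letter z * (letter y * b) - letter ?yz * b) =
     (letter y * (letter z * act x b) - letter z * (letter y * act x b) - letter ?yz * act x b)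
     + (rho ?xy (letter z * b) - letter z * rho ?xy b - rho (lie_bracket ?xy z) b)
     - (rho ?xz (letter y * b) - letter y * rho ?xz b - rho (lie_bracket ?xz y) b)
     - (rho (lie_bracket x ?yz) b - (rho (lie_bracket ?xy z) b - rho (lie_bracket ?xz y) b))"
    by (simp add: act_simps act_letter algebra_simps)
  also have "\<dots> \<in> rel"
    by (intro rel_diff rel.add[OF 1 2] 3 4)
  finally show ?case .
next
  case (left p y)
  \<comment> \<open>The commutator brings in the action of \<open>lie_bracket x y\<close>, hence the
    induction over arbitrary \<open>x\<close>.\<close>
  then show ?case
    by (simp add: act_letter rho_def rel.add rel.left)
qed (simp_all add: act_simps rel.zero rel.add)

lemma rho_rel: "p \<in> rel \<Longrightarrow> rho x p \<in> rel"
  by (simp add: rho_def rel.add rel.left act_rel)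

text \<open>On the empty word every term is zero. Moving both operators past a first letter z leaves
  [x,[y,z]] and [y,[x,z]], which the Jacobi identity combines into [[x,y],z].\<close>

lemma act_bracket:
  assumes "x \<in> \<hh>" "y \<in> \<hh>"
  shows "act x (act y p) - act y (act x p) - act (lie_bracket x y) p \<in> rel"
proof (rule rel_on_words[where F = "\<lambda>p. act x (act y p) - act y (act x p) - act (lie_bracket x y) p"])
  show "clinear (\<lambda>p. act x (act y p) - act y (act x p) - act (lie_bracket x y) p)"
    by (intro clinear_intros clinear_fun_act)
  show "act x (act y (Poly_Mapping.single w 1)) - act y (act x (Poly_Mapping.single w 1))
      - act (lie_bracket x y) (Poly_Mapping.single w 1) \<in> rel" for w
    using assms
  proof (induction w arbitrary: x y)
    case Nil
    then show ?case
      by (simp add: act_single act_simps rel.zero)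
  next
    case (Cons z w)
    let ?b = "Poly_Mapping.single w 1 :: 'g list \<Rightarrow>\<^sub>0 complex"
    \<comment> \<open>On the shorter word, the induction hypothesis handles the component of
      \<open>u\<close> in \<open>\<hh>\<close>, while \<open>act_letter\<close> handles the one in
      \<open>\<vv>\<close> exactly.\<close>
    have comm: "act x (rho u ?b) - rho u (act x ?b) - rho (lie_bracket x u) ?b \<in> rel"
      if x: "x \<in> \<hh>" for x u
    proof -
      let ?h = "lie_bracket x (ph u)" and ?v = "lie_bracket x (pv u)"
      have u: "lie_bracket x u = ?h + ?v"
        by (simp add: ph_pv flip: lie_bracket_add_right)
      note 1 = Cons.IH[OF x ph_in[of u]]
      note 2 = rho_hh[OF bracket_hh[OF x ph_in[of u]], of ?b]
      note 3 = rho_add[of ?h ?v ?b]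
      have "act x (rho u ?b) - rho u (act x ?b) - rho (lie_bracket x u) ?b =
        (act x (act (ph u) ?b) - act (ph u) (act x ?b) - act ?h ?b) - (rho ?h ?b - act ?h ?b)
        - (rho (?h + ?v) ?b - rho ?h ?b - rho ?v ?b)"
        unfolding u by (simp add: rho_def[of u] act_simps act_letter algebra_simps)
      also have "\<dots> \<in> rel"
        by (intro rel_diff 1 2 3)
      finally show ?thesis .
    qed
    let ?yz = "lie_bracket y z" and ?xz = "lie_bracket x z" and ?xy = "lie_bracket x y"
    note 1 = rel.left[OF Cons.IH[OF Cons.prems], of z]
    note 2 = comm[OF Cons.prems(1), of ?yz]
    note 3 = comm[OF Cons.prems(2), of ?xz]
    note 4 = rho_diff[of "lie_bracket x ?yz" "lie_bracket y ?xz" ?b, folded lie_jacobi_left]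
    have "act x (act y (letter z * ?b)) - act y (act x (letter z * ?b)) - act ?xy (letter z * ?b) =
      letter z * (act x (act y ?b) - act y (act x ?b) - act ?xy ?b)
      + (act x (rho ?yz ?b) - rho ?yz (act x ?b) - rho (lie_bracket x ?yz) ?b)
      - (act y (rho ?xz ?b) - rho ?xz (act y ?b) - rho (lie_bracket y ?xz) ?b)
      - (rho (lie_bracket ?xy z) ?b - (rho (lie_bracket x ?yz) ?b - rho (lie_bracket y ?xz) ?b))"
      by (simp add: act_simps act_letter algebra_simps)
    also have "\<dots> \<in> rel"
      by (intro rel_diff rel.add[OF 1 2] 3 4)
    finally show ?case
      by (simp only: single_Cons[of z w])
  qed
qed

text \<open>Split \<open>x\<close> into components. The part \<open>pv x\<close> is a letter from
  \<open>\<vv>\<close>, so \<open>rho_letter\<close> moves \<open>rho y\<close> past it. The part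
  \<open>ph x\<close> is commuted with \<open>ph y\<close> by \<open>act_bracket\<close> and with
  \<open>pv y\<close> by \<open>act_letter\<close>.\<close>

lemma rho_bracket: "rho x (rho y p) - rho y (rho x p) - rho (lie_bracket x y) p \<in> rel"
proof -
  let ?hy = "lie_bracket (ph x) y" and ?vy = "lie_bracket (pv x) y"
  let ?hh = "lie_bracket (ph x) (ph y)" and ?hv = "lie_bracket (ph x) (pv y)"
  have x: "lie_bracket x y = ?hy + ?vy" and y: "?hy = ?hh + ?hv"
    by (simp_all add: ph_pv flip: lie_bracket_add_left lie_bracket_add_right)
  have 1: "rho y (letter (pv x) * p) - letter (pv x) * rho y p - rho (- ?vy) p \<in> rel"
    using rho_letter[OF pv_in[of x], of y p] by (simp add: lie_bracket_antisym[of "pv x" y])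
  have 2: "rho (- ?vy) p + rho ?vy p \<in> rel"
    using rho_scaleC[of "-1" ?vy p] by simp
  note 3 = act_bracket[OF ph_in[of x] ph_in[of y], of p]
  note 4 = rho_hh[OF bracket_hh[OF ph_in[of x] ph_in[of y]], of p]
  note 5 = rho_add[of ?hh ?hv p, folded y] and 6 = rho_add[of ?hy ?vy p, folded x]
  \<comment> \<open>The last summand is zero by definition of \<open>rho\<close>; it trades
    \<open>rho y (act (ph x) p)\<close> for its two parts.\<close>
  have "rho x (rho y p) - rho y (rho x p) - rho (lie_bracket x y) p =
    (act (ph x) (act (ph y) p) - act (ph y) (act (ph x) p) - act ?hh p)
    - (rho y (letter (pv x) * p) - letter (pv x) * rho y p - rho (- ?vy) p)
    - (rho (- ?vy) p + rho ?vy p) - (rho ?hh p - act ?hh p)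
    - (rho ?hy p - rho ?hh p - rho ?hv p)
    - (rho (lie_bracket x y) p - rho ?hy p - rho ?vy p)
    - (rho y (act (ph x) p) - letter (pv y) * act (ph x) p - act (ph y) (act (ph x) p))"
    unfolding rho_def[of x "rho y p"] rho_def[of x p] clinear_add[OF clinear_rho]
    by (simp add: rho_def[of y p] act_simps act_letter algebra_simps)
  also have "\<dots> \<in> rel"
    by (rule rel_diff[OF rel_diff[OF rel_diff[OF rel_diff[OF rel_diff[OF rel_diff[OF 3 1] 2] 4] 5] 6]])
      (simp add: rho_def[of y "act (ph x) p"] rel.zero)
  finally show ?thesis .
qed


section \<open>The action of the free algebra and its descent to the enveloping algebra\<close>

definition rho_free :: "('g list \<Rightarrow>\<^sub>0 complex) \<Rightarrow> ('g list \<Rightarrow>\<^sub>0 complex) \<Rightarrow> 'g list \<Rightarrow>\<^sub>0 complex" where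
  "rho_free a p = lin_ext (\<lambda>w. foldr rho w p) a"

lemma clinear_rho_free_left: "clinear (\<lambda>a. rho_free a p)"
  by (simp add: rho_free_def clinear_lin_ext)

lemma clinear_foldr_rho: "clinear (foldr rho w)"
proof (induction w)
  case (Cons x w)
  then show ?case
    using clinear_compose[OF clinear_rho Cons] by (simp add: comp_def)
qed (simp add: id_def clinear_ident)

lemma clinear_rho_free: "clinear (rho_free a)"
  by (rule clinearI) (simp_all add: rho_free_def lin_ext_def clinear_add[OF clinear_foldr_rho]
      clinear_scale[OF clinear_foldr_rho] scaleC_add_right sum.distrib cvec.scale_sum_right
      scaleC_scaleC mult.commute)

lemma rho_free_single: "rho_free (Poly_Mapping.single w 1) p = foldr rho w p"
  by (simp add: rho_free_def lin_ext_single scaleC_one)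

text \<open>\<open>foldr\<close> applies the last letter of a word first, which is what makes this a
  left action.\<close>

lemma rho_free_mult: "rho_free (a * b) p = rho_free a (rho_free b p)"
proof -
  have mult: "clinear (\<lambda>a. a * c)" "clinear (\<lambda>a. c * a)" for c :: "'g list \<Rightarrow>\<^sub>0 complex"
    by (intro clinear_intros)+
  have single: "rho_free (Poly_Mapping.single w 1 * b) p = rho_free (Poly_Mapping.single w 1) (rho_free b p)"
    for w
    by (rule clinear_eq_on_singles[where f = "\<lambda>b. rho_free (Poly_Mapping.single w 1 * b) p"
          and g = "\<lambda>b. rho_free (Poly_Mapping.single w 1) (rho_free b p)",
          OF clinear_compose[OF clinear_rho_free_left mult(2)]
            clinear_compose[OF clinear_rho_free clinear_rho_free_left]])
      (simp add: mult_single plus_list_def rho_free_single)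
  show ?thesis
    by (rule clinear_eq_on_singles[where f = "\<lambda>a. rho_free (a * b) p"
          and g = "\<lambda>a. rho_free a (rho_free b p)",
          OF clinear_compose[OF clinear_rho_free_left mult(1)] clinear_rho_free_left single])
qed

lemma rho_free_rel: "p \<in> rel \<Longrightarrow> rho_free a p \<in> rel"
proof -
  assume p: "p \<in> rel"
  have "foldr rho w p \<in> rel" for w
    by (induction w) (auto simp: p rho_rel)
  then show ?thesis
    unfolding rho_free_def lin_ext_def by (intro rel_sum rel_scale)
qed

text \<open>Linearity and the bracket law of \<open>rho\<close> settle the generators; products use
  that the action preserves \<open>rel\<close>. Thus the action modulo \<open>rel\<close> factors
  through the enveloping algebra.\<close>

lemma rho_free_uea_ideal: "a \<in> uea_ideal \<Longrightarrow> rho_free a p \<in> rel"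
proof (induction arbitrary: p rule: uea_ideal.induct)
  case (gen_add x y)
  then show ?case using rho_add[of x y p]
    by (simp add: clinear_diff[OF clinear_rho_free_left] rho_free_single)
next
  case (gen_scale c x)
  then show ?case using rho_scaleC[of c x p]
    by (simp add: clinear_diff[OF clinear_rho_free_left] clinear_scale[OF clinear_rho_free_left]
        rho_free_single)
next
  case (gen_bracket x y)
  then show ?case using rho_bracket[of x y p]
    by (simp only: clinear_diff[OF clinear_rho_free_left] rho_free_single rho_free_mult) simp
next
  case zero
  then show ?case by (simp add: clinear_0[OF clinear_rho_free_left] rel.zero)
next
  case (add a b)
  then show ?case by (simp add: clinear_add[OF clinear_rho_free_left] rel.add)
next
  case (mult q a b)
  then show ?case by (simp add: rho_free_mult rho_free_rel)
qed



section \<open>Acting on 1\<close>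

lemma foldr_rho_vv: "set w \<subseteq> \<vv> \<Longrightarrow> foldr rho w 1 - Poly_Mapping.single w 1 \<in> rel"
proof (induction w)
  case Nil
  have "Poly_Mapping.single [] 1 = (1 :: 'g list \<Rightarrow>\<^sub>0 complex)"
    by (metis single_one zero_list_def)
  then show ?case by (simp add: rel.zero)
next
  case (Cons x w)
  then have "rho x (foldr rho w 1 - Poly_Mapping.single w 1)
      + (rho x (Poly_Mapping.single w 1) - letter x * Poly_Mapping.single w 1) \<in> rel"
    by (intro rel.add rho_rel rho_vv) auto
  then show ?case
    by (simp add: single_Cons[of x w] clinear_diff[OF clinear_rho])
qed

text \<open>Letters from \<open>\<vv>\<close> act by left multiplication modulo \<open>rel\<close>,
  so a word in them, applied to 1, returns itself. The property belongs to the representative, which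
  is therefore built from such words.\<close>

lemma uea_sub_vv_rep:
  assumes "u \<in> uea_sub \<vv>"
  shows "\<exists>p. u = abs_uea p \<and> rho_free p 1 - p \<in> rel"
  using assms unfolding uea_sub_def
proof (induction rule: cvec.span_induct_alt)
  case base
  show ?case
    by (rule exI[of _ 0]) (simp add: zero_uea_def clinear_0[OF clinear_rho_free_left] rel.zero)
next
  case (step c x y)
  then obtain w q where w: "set w \<subseteq> \<vv>" "x = prod_list (map uea_gen w)"
    and q: "y = abs_uea q" "rho_free q 1 - q \<in> rel"
    by blast
  let ?p = "Poly_Mapping.single w 1 :: 'g list \<Rightarrow>\<^sub>0 complex"
  have "c *\<^sub>C x + y = abs_uea (c *\<^sub>C ?p + q)"
    by (simp add: w q prod_list_uea_gen scaleC_uea.abs_eq plus_uea.abs_eq)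
  moreover have "rho_free (c *\<^sub>C ?p + q) 1 - (c *\<^sub>C ?p + q)
      = c *\<^sub>C (foldr rho w 1 - ?p) + (rho_free q 1 - q)"
    by (simp add: clinear_add[OF clinear_rho_free_left] clinear_scale[OF clinear_rho_free_left]
        rho_free_single cvec.scale_right_diff_distrib)
  ultimately show ?case
    using rel.add[OF rel_scale[OF foldr_rho_vv[OF w(1)], of c] q(2)] by metis
qed

text \<open>A product ending in an element of \<open>\<hh>\<close> kills 1 modulo
  \<open>rel\<close>, because its last factor already does.\<close>

lemma uea_left_ideal_rep:
  assumes "u \<in> uea_left_ideal \<hh>"
  shows "\<exists>p. u = abs_uea p \<and> rho_free p 1 \<in> rel"
  using assms unfolding uea_left_ideal_def
proof (induction rule: cvec.span_induct_alt)
  case base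
  show ?case
    by (rule exI[of _ 0]) (simp add: zero_uea_def clinear_0[OF clinear_rho_free_left] rel.zero)
next
  case (step c x y)
  then obtain u h q where h: "h \<in> \<hh>" "x = u * uea_gen h" and q: "y = abs_uea q" "rho_free q 1 \<in> rel"
    by blast
  obtain a where a: "u = abs_uea a"
    using abs_uea_surj by blast
  have "rho h 1 \<in> rel"
    using rho_hh[OF h(1), of 1] by (simp add: act_1)
  then have "c *\<^sub>C rho_free a (rho h 1) + rho_free q 1 \<in> rel"
    by (intro rel.add rel_scale rho_free_rel q)
  moreover have "c *\<^sub>C x + y = abs_uea (c *\<^sub>C (a * letter h) + q)"
    by (simp add: h q a uea_gen.abs_eq times_uea.abs_eq scaleC_uea.abs_eq plus_uea.abs_eq)
  ultimately show ?case
    by (intro exI[of _ "c *\<^sub>C (a * letter h) + q"])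
      (simp add: clinear_add[OF clinear_rho_free_left] clinear_scale[OF clinear_rho_free_left]
        rho_free_mult rho_free_single)
qed

text \<open>Two representatives of \<open>u\<close> act alike on 1 modulo \<open>rel\<close>. One
  gives itself and the other gives 0, so the first lies in \<open>rel\<close> and represents
  0.\<close>

lemma uea_sub_inter_left_ideal:
  assumes "u \<in> uea_sub \<vv>" "u \<in> uea_left_ideal \<hh>"
  shows "u = 0"
proof -
  obtain p where p: "u = abs_uea p" "rho_free p 1 - p \<in> rel"
    using uea_sub_vv_rep[OF assms(1)] by blast
  obtain q where q: "u = abs_uea q" "rho_free q 1 \<in> rel"
    using uea_left_ideal_rep[OF assms(2)] by blast
  have "p - q \<in> uea_ideal"
    using p q by (metis uea.abs_eq_iff)
  then have "rho_free p 1 - rho_free q 1 \<in> rel"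
    using rho_free_uea_ideal[of "p - q" 1] by (simp add: clinear_diff[OF clinear_rho_free_left])
  then have "(rho_free p 1 - rho_free q 1) + rho_free q 1 - (rho_free p 1 - p) \<in> rel"
    by (rule rel_diff[OF rel.add[OF _ q(2)] p(2)])
  then have "p \<in> uea_ideal"
    by (intro rel_subset_uea_ideal) simp
  then show ?thesis
    using p(1) by (simp add: zero_uea_def uea.abs_eq_iff)
qed

section \<open>The decomposition of the enveloping algebra\<close>

definition uea_sum :: "'g uea set" where
  "uea_sum = {a + b |a b. a \<in> uea_sub \<vv> \<and> b \<in> uea_left_ideal \<hh>}"

lemma subspace_uea_sum: "cvec.subspace uea_sum"
  unfolding uea_sum_def by (rule cvec.subspace_sums[OF subspace_uea_sub subspace_uea_left_ideal])

lemma uea_sum_vv: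
  assumes "x \<in> \<vv>" "u \<in> uea_sum"
  shows "uea_gen x * u \<in> uea_sum"
proof -
  obtain a b where "u = a + b" "a \<in> uea_sub \<vv>" "b \<in> uea_left_ideal \<hh>"
    using assms(2) by (auto simp: uea_sum_def)
  moreover from this have "uea_gen x * a \<in> uea_sub \<vv>" "uea_gen x * b \<in> uea_left_ideal \<hh>"
    using assms(1) by (auto intro: uea_sub_mult uea_sub_gen uea_left_ideal_mult)
  ultimately show ?thesis
    unfolding uea_sum_def by (auto simp: distrib_left)
qed

text \<open>By xy = yx + [x,y], moving \<open>x\<close> past the first letter leaves the shorter
  word preceded by \<open>x\<close> or by a component of [x,y]. The \<open>\<hh>\<close> component
  takes the place of \<open>x\<close>, so \<open>x\<close> is generalised.\<close>

lemma uea_sum_hh_word: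
  assumes "set w \<subseteq> \<vv>" "x \<in> \<hh>"
  shows "uea_gen x * prod_list (map uea_gen w) \<in> uea_sum"
  using assms
proof (induction w arbitrary: x)
  case Nil
  have "0 + 1 * uea_gen x \<in> uea_sum"
    unfolding uea_sum_def
    using cvec.subspace_0[OF subspace_uea_sub] uea_left_ideal_gen[OF Nil(2), of 1] by blast
  then show ?case by simp
next
  case (Cons y w)
  let ?w = "prod_list (map uea_gen w)" and ?xy = "lie_bracket x y"
  have w: "?w \<in> uea_sum"
    unfolding uea_sum_def
    using cvec.subspace_0[OF subspace_uea_left_ideal] uea_sub_prod[of w \<vv>] Cons.prems by force
  have xy: "uea_gen x * uea_gen y = uea_gen y * uea_gen x + uea_gen (ph ?xy) + uea_gen (pv ?xy)"
    using uea_gen_simps(2)[of x y] uea_gen_simps(1)[of "ph ?xy" "pv ?xy"] ph_pv[of ?xy]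
    by (simp add: algebra_simps)
  have "uea_gen y * (uea_gen x * ?w) + uea_gen (ph ?xy) * ?w + uea_gen (pv ?xy) * ?w \<in> uea_sum"
    using Cons.prems
    by (intro cvec.subspace_add[OF subspace_uea_sum] Cons.IH uea_sum_vv pv_in ph_in w) auto
  also have "uea_gen y * (uea_gen x * ?w) + uea_gen (ph ?xy) * ?w + uea_gen (pv ?xy) * ?w
      = uea_gen x * uea_gen y * ?w"
    unfolding xy by (simp add: distrib_right mult.assoc)
  finally show ?case by (simp add: mult.assoc)
qed

lemma uea_sum_hh:
  assumes "x \<in> \<hh>" "u \<in> uea_sum"
  shows "uea_gen x * u \<in> uea_sum"
proof -
  obtain a b where ab: "u = a + b" "a \<in> uea_sub \<vv>" "b \<in> uea_left_ideal \<hh>"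
    using assms(2) by (auto simp: uea_sum_def)
  have "uea_gen x * a \<in> uea_sum"
    using ab(2) unfolding uea_sub_def
  proof (induction rule: cvec.span_induct_alt)
    case base
    show ?case using cvec.subspace_0[OF subspace_uea_sum] by simp
  next
    case (step c a b)
    then have "uea_gen x * a \<in> uea_sum"
      using uea_sum_hh_word[OF _ assms(1)] by blast
    then show ?case
      using step.IH cvec.subspace_add[OF subspace_uea_sum] cvec.subspace_scale[OF subspace_uea_sum]
      by (simp add: distrib_left mult_scaleC_right)
  qed
  moreover have "uea_gen x * b \<in> uea_sum"
    unfolding uea_sum_def
    using uea_left_ideal_mult[OF ab(3)] cvec.subspace_0[OF subspace_uea_sub] by force
  ultimately show ?thesis
    by (simp add: ab distrib_left cvec.subspace_add[OF subspace_uea_sum])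
qed

text \<open>The sum contains 1 and is closed under left multiplication by every generator, hence
  contains all words, and these span.\<close>

lemma uea_sum_UNIV: "u \<in> uea_sum"
proof -
  have word: "abs_uea (Poly_Mapping.single w 1) \<in> uea_sum" for w
    unfolding prod_list_uea_gen[symmetric]
  proof (induction w)
    case Nil
    then show ?case
      unfolding uea_sum_def
      using uea_sub_1[of \<vv>] cvec.subspace_0[OF subspace_uea_left_ideal] by force
  next
    case (Cons x w)
    have "uea_gen x = uea_gen (ph x) + uea_gen (pv x)"
      using uea_gen_simps(1)[of "ph x" "pv x"] ph_pv[of x] by simp
    then show ?case
      using Cons by (simp add: distrib_right cvec.subspace_add[OF subspace_uea_sum]
          uea_sum_hh[OF ph_in] uea_sum_vv[OF pv_in])
  qed
  obtain p where p: "u = abs_uea p"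
    using abs_uea_surj by blast
  let ?s = "\<lambda>w. Poly_Mapping.single w (Poly_Mapping.lookup p w)"
  have "abs_uea (sum ?s S) \<in> uea_sum" for S
  proof (induction S rule: infinite_finite_induct)
    case (insert w S)
    have "?s w = Poly_Mapping.lookup p w *\<^sub>C Poly_Mapping.single w 1"
      by (simp add: scaleC_single scaleC_complex_def)
    then have "abs_uea (?s w) \<in> uea_sum"
      using cvec.subspace_scale[OF subspace_uea_sum word] by (simp add: scaleC_uea.abs_eq)
    then show ?case
      using insert cvec.subspace_add[OF subspace_uea_sum] by (simp add: plus_uea.abs_eq[symmetric])
  qed (use cvec.subspace_0[OF subspace_uea_sum] in \<open>simp_all add: zero_uea_def\<close>)
  then show ?thesis
    unfolding p using poly_mapping_sum_single[of p] by metis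
qed

lemma direct_sum_uea: "direct_sum (uea_sub \<vv>) (uea_left_ideal \<hh>) UNIV"
  unfolding direct_sum_def
  using uea_sum_UNIV uea_sub_inter_left_ideal cvec.subspace_0[OF subspace_uea_left_ideal]
    cvec.subspace_0[OF subspace_uea_sub]
  by (auto simp: uea_sum_def)


section \<open>Projecting twists\<close>

definition P :: "'g uea \<Rightarrow> 'g uea" where
  "P = proj_along (uea_sub \<vv>) (uea_left_ideal \<hh>)"

definition P2 :: "'g uea2 \<Rightarrow> 'g uea2" where "P2 = tensor_map P P"

definition P3 :: "'g uea3 \<Rightarrow> 'g uea3" where "P3 = tensor_map P2 P"

lemma clinear_P: "clinear P" and P_in: "P u \<in> uea_sub \<vv>"
  and minus_P_in: "u - P u \<in> uea_left_ideal \<hh>"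
  and P_id: "u \<in> uea_sub \<vv> \<Longrightarrow> P u = u" and P_zero: "u \<in> uea_left_ideal \<hh> \<Longrightarrow> P u = 0"
  unfolding P_def
  using clinear_proj_along[OF subspace_uea_sub subspace_uea_left_ideal direct_sum_uea]
    proj_along_in[OF subspace_uea_sub subspace_uea_left_ideal direct_sum_uea]
    minus_proj_along_in[OF subspace_uea_sub subspace_uea_left_ideal direct_sum_uea]
    proj_along_id[OF subspace_uea_sub subspace_uea_left_ideal direct_sum_uea]
    proj_along_zero[OF subspace_uea_sub subspace_uea_left_ideal direct_sum_uea]
  by blast+

lemma clinear_P2: "clinear P2"
  unfolding P2_def by (intro clinear_tensor_map clinear_P)

lemma clinear_P3: "clinear P3"
  unfolding P3_def by (intro clinear_tensor_map clinear_P clinear_P2)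

lemma P2_pure: "P2 (a \<otimes> b) = P a \<otimes> P b"
  by (simp add: P2_def tensor_map_pure clinear_P)

lemma P3_pure: "P3 (t \<otimes> b) = P2 t \<otimes> P b"
  by (simp add: P3_def tensor_map_pure clinear_P clinear_P2)

lemma P_1: "P 1 = 1"
  by (simp add: P_id uea_sub_1)

text \<open>The kernel of \<open>P\<close> is a left ideal, so a right factor may be replaced by its
  projection.\<close>

lemma P_mult: "P (u * P v) = P (u * v)"
proof -
  have "P (u * (v - P v)) = 0"
    by (intro P_zero uea_left_ideal_mult minus_P_in)
  then show ?thesis
    by (simp add: right_diff_distrib clinear_diff[OF clinear_P])
qed

lemma P_mult_vv: "u \<in> uea_sub \<vv> \<Longrightarrow> P (u * P v) = u * P v"
  by (simp add: P_id uea_sub_mult P_in)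

lemma P2_mult: "P2 (s * P2 t) = P2 (s * t)"
proof -
  have mult: "clinear (\<lambda>x. x * t)" "clinear (\<lambda>x. t * x)" for t :: "'g uea2"
    by (intro clinear_intros)+
  have 1: "P2 (s * P2 (c \<otimes> d)) = P2 (s * (c \<otimes> d))" for c d
    by (rule clinear_eq_on_pure[OF clinear_compose[OF clinear_P2 mult(1)] clinear_compose[OF clinear_P2 mult(1)]])
      (simp add: P2_pure tensor_mult_pure P_mult)
  show ?thesis
    by (rule clinear_eq_on_pure[OF clinear_compose[OF clinear_P2 clinear_compose[OF mult(2) clinear_P2]]
          clinear_compose[OF clinear_P2 mult(2)] 1])
qed

section \<open>Projection of products with a comultiplication\<close>

lemma P2_comult_gen_vv:
  assumes "x \<in> \<vv>" "P2 t = t"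
  shows "P2 (comult (uea_gen x) * t) = comult (uea_gen x) * t"
proof -
  have mult: "clinear (\<lambda>x. t * x)" for t :: "'g uea2"
    by (intro clinear_intros)
  have "P2 (comult (uea_gen x) * P2 s) = comult (uea_gen x) * P2 s" for s
    by (rule clinear_eq_on_pure[OF clinear_compose[OF clinear_P2 clinear_compose[OF mult clinear_P2]]
          clinear_compose[OF mult clinear_P2]])
      (simp add: P2_pure tensor_mult_pure comult_gen distrib_right clinear_add[OF clinear_P2]
        P_mult_vv uea_sub_gen assms(1) P_id[OF P_in])
  from this[of t] show ?thesis
    by (simp add: assms(2))
qed

text \<open>The hypothesis \<open>P2 t = t\<close> expresses that \<open>t\<close> lies in the
  tensor square of \<open>uea_sub \<vv>\<close>; left multiplication by the comultiplication of a
  generator from \<open>\<vv>\<close> preserves this, hence so does that of a word.\<close>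

lemma P2_comult_vv:
  assumes "u \<in> uea_sub \<vv>" "P2 t = t"
  shows "P2 (comult u * t) = comult u * t"
  using assms(1) unfolding uea_sub_def
proof (induction rule: cvec.span_induct_alt)
  case base
  show ?case
    by (simp add: clinear_0[OF clinear_comult] clinear_0[OF clinear_P2])
next
  case (step c u v)
  then obtain w where w: "set w \<subseteq> \<vv>" "u = prod_list (map uea_gen w)"
    by blast
  have "P2 (comult (prod_list (map uea_gen w)) * t) = comult (prod_list (map uea_gen w)) * t"
    using w(1) by (induction w) (simp_all add: comult_1 comult_mult mult.assoc assms(2) P2_comult_gen_vv)
  then show ?case
    using step.IH
    by (simp add: w(2) clinear_add[OF clinear_comult] clinear_scale[OF clinear_comult] distrib_right
        mult_scaleC_left clinear_add[OF clinear_P2] clinear_scale[OF clinear_P2])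
qed

text \<open>Invariance moves the comultiplication of a generator h from \<open>\<hh>\<close> to the
  right of \<open>t\<close>. There \<open>P2_mult\<close> replaces it by its projection, which is 0
  because \<open>P\<close> kills h in either leg.\<close>

lemma P2_comult_hh:
  assumes "t \<in> invariants \<hh>" "u \<in> uea_left_ideal \<hh>"
  shows "P2 (comult u * t) = 0"
  using assms(2) unfolding uea_left_ideal_def
proof (induction rule: cvec.span_induct_alt)
  case base
  show ?case
    by (simp add: clinear_0[OF clinear_comult] clinear_0[OF clinear_P2])
next
  case (step c u v)
  then obtain a x where x: "x \<in> \<hh>" "u = a * uea_gen x"
    by blast
  have "P (uea_gen x) = 0"
    using uea_left_ideal_gen[OF x(1), of 1] by (simp add: P_zero)
  then have 0: "P2 (comult (uea_gen x)) = 0"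
    by (simp add: comult_gen clinear_add[OF clinear_P2] P2_pure clinear_0[OF clinear_pure_left]
        clinear_0[OF clinear_pure_right])
  have "comult (uea_gen x) * t = t * comult (uea_gen x)"
    using assms(1) x(1) by (simp add: invariants_def)
  then have "comult u * t = comult a * t * comult (uea_gen x)"
    by (simp add: x(2) comult_mult mult.assoc)
  then have "P2 (comult u * t) = 0"
    using P2_mult[of "comult a * t" "comult (uea_gen x)"]
    by (simp add: 0 clinear_0[OF clinear_P2])
  then show ?case
    using step.IH
    by (simp add: clinear_add[OF clinear_comult] clinear_scale[OF clinear_comult] distrib_right
        mult_scaleC_left clinear_add[OF clinear_P2] clinear_scale[OF clinear_P2] cvec.scale_zero_right)
qed

lemma P2_idem: "P2 (P2 t) = P2 t"
  using P2_mult[of 1 t] by simp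

text \<open>
  In general \<^term>\<open>P (u * v)\<close> does not depend on \<^term>\<open>P u\<close> alone; the invariance of \<^term>\<open>t\<close> is what
  allows the part of \<^term>\<open>u\<close> in the left ideal to be moved to the right of \<^term>\<open>t\<close>.
\<close>

lemma P2_comult:
  assumes "t \<in> invariants \<hh>"
  shows "P2 (comult u * t) = comult (P u) * P2 t"
proof -
  have "P2 (comult (u - P u) * t) = 0"
    by (rule P2_comult_hh[OF assms minus_P_in])
  then have "P2 (comult u * t) = P2 (comult (P u) * t)"
    by (simp add: clinear_diff[OF clinear_comult] left_diff_distrib clinear_diff[OF clinear_P2])
  also have "\<dots> = P2 (comult (P u) * P2 t)"
    by (simp add: P2_mult)
  also have "\<dots> = comult (P u) * P2 t"
    by (rule P2_comult_vv[OF P_in P2_idem])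
  finally show ?thesis .
qed

section \<open>Both sides of the dynamical equation under \<open>P3\<close>\<close>

lemma P3_leg_12_3:
  assumes "B \<in> invariants \<hh>"
  shows "P3 (leg_12_3 A * leg_12 B) = leg_12_3 (P2 A) * leg_12 (P2 B)"
proof -
  have mult: "clinear (\<lambda>x. x * t)" for t :: "'g uea3"
    by (intro clinear_intros)
  have leg: "clinear (leg_12_3 :: 'g uea2 \<Rightarrow> _)"
    unfolding leg_12_3_def by (intro clinear_tensor_map clinear_comult clinear_id)
  show ?thesis
    \<comment> \<open>For A = a \<otimes> b the product is (comult a * B) \<otimes> b, so
      \<open>P2_comult\<close> applies to the first two legs.\<close>
    by (rule clinear_eq_on_pure[OF clinear_compose[OF clinear_P3 clinear_compose[OF mult leg]]
          clinear_compose[OF mult clinear_compose[OF leg clinear_P2]]])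
      (simp add: leg_12_3_pure leg_12_def tensor_mult_pure P3_pure P2_pure P2_comult[OF assms])
qed

lemma P3_tensor_assoc: "P3 (tensor_assoc t) = tensor_assoc (tensor_map P P2 t)"
  by (simp add: P3_def P2_def tensor_assoc_tensor_map clinear_P)

text \<open>For A = a \<otimes> b the product is \<open>tensor_assoc\<close> of a \<otimes> (comult
  b * B). Crossing the associator turns \<open>P3\<close> into \<open>P\<close> on the first leg and
  \<open>P2\<close> on the other two, where \<open>P2_comult\<close> applies.\<close>

lemma P3_leg_1_23:
  assumes "B \<in> invariants \<hh>"
  shows "P3 (leg_1_23 A * leg_23 B) = leg_1_23 (P2 A) * leg_23 (P2 B)"
proof -
  have mult: "clinear (\<lambda>x. x * t)" for t :: "'g uea3"
    by (intro clinear_intros)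
  have leg: "clinear (leg_1_23 :: 'g uea2 \<Rightarrow> _)"
    unfolding leg_1_23_def
    by (intro clinear_compose[OF clinear_tensor_assoc] clinear_tensor_map clinear_comult clinear_id)
  show ?thesis
    by (rule clinear_eq_on_pure[OF clinear_compose[OF clinear_P3 clinear_compose[OF mult leg]]
          clinear_compose[OF mult clinear_compose[OF leg clinear_P2]]])
      (simp add: leg_1_23_pure leg_23_def P3_tensor_assoc P2_pure P2_comult[OF assms]
        tensor_map_pure clinear_P clinear_P2 tensor_mult_pure flip: tensor_assoc_mult)
qed

text \<open>Whatever \<open>s\<close> contributes to the third leg stands to the left of
  \<open>uea_gen x\<close>, so that leg remains in the left ideal.\<close>

lemma P3_third_leg:
  assumes "x \<in> \<hh>"
  shows "P3 (s * (t \<otimes> (u * uea_gen x))) = 0"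
proof -
  have mult: "clinear (\<lambda>x. x * t)" for t :: "'g uea3"
    by (intro clinear_intros)
  have zero: "clinear (\<lambda>_::'g uea3. 0 :: 'g uea3)"
    by (rule clinearI) simp_all
  have "P (a * (u * uea_gen x)) = 0" for a
    by (rule P_zero[OF uea_left_ideal_mult[OF uea_left_ideal_gen[OF assms]]])
  then show ?thesis
    by - (rule clinear_eq_on_pure[OF clinear_compose[OF clinear_P3 mult] zero],
      simp add: tensor_mult_pure P3_pure clinear_0[OF clinear_pure_right])
qed

lemma P3_dynamical_shift:
  assumes "B \<subseteq> \<hh>"
  shows "P3 (s * fps_nth (dynamical_shift B J l) n) = P3 (s * leg_12 (fps_nth (J l) n))"
proof -
  let ?T = "\<lambda>k. ((- 1) ^ k / fact k) *\<^sub>C (\<Sum>bs | set bs \<subseteq> B \<and> length bs = k.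
        partials_dual B bs (\<lambda>l. fps_nth (J l) (n - k)) l \<otimes> prod_list (map uea_gen bs))"
  have "{bs. set bs \<subseteq> B \<and> length bs = 0} = {[]}"
    by auto
  then have T0: "?T 0 = leg_12 (fps_nth (J l) n)"
    by (simp add: leg_12_def scaleC_one)
  have T: "P3 (s * ?T (Suc k)) = 0" for k
  proof -
    have "P3 (s * (t \<otimes> prod_list (map uea_gen bs))) = 0"
      if bs: "set bs \<subseteq> B" "length bs = Suc k" for bs and t
    proof -
      \<comment> \<open>Membership in the left ideal is decided by the rightmost factor, so the last
        basis vector is split off.\<close>
      obtain bs' x where "bs = bs' @ [x]"
        using bs(2) by (metis length_Suc_conv_rev)
      then show ?thesis
        using bs(1) assms P3_third_leg[of x s t "prod_list (map uea_gen bs')"] by auto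
    qed
    then show ?thesis
      by (simp only: mult_scaleC_right sum_distrib_left clinear_scale[OF clinear_P3]
          clinear_sum[OF clinear_P3]) (simp add: cvec.scale_zero_right)
  qed
  have "fps_nth (dynamical_shift B J l) n = (\<Sum>k\<le>n. ?T k)"
    by (simp add: dynamical_shift_def)
  also have "\<dots> = leg_12 (fps_nth (J l) n) + (\<Sum>k<n. ?T (Suc k))"
    unfolding sum.atMost_shift T0 ..
  finally show ?thesis
    by (simp only: distrib_left sum_distrib_left clinear_add[OF clinear_P3] clinear_sum[OF clinear_P3] T)
      simp
qed

section \<open>The counit condition\<close>

lemma counit_left_ideal: "u \<in> uea_left_ideal \<hh> \<Longrightarrow> counit u = 0"
  unfolding uea_left_ideal_def
proof (induction rule: cvec.span_induct_alt)
  case base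
  show ?case by (simp add: clinear_0[OF clinear_counit])
next
  case (step c u v)
  then obtain a x where "u = a * uea_gen x"
    by blast
  then have "counit u = 0"
    by (simp add: counit_def uea_lift_mult uea_lift_gen lie_hom_zero)
  then show ?case
    using step.IH by (simp add: clinear_add[OF clinear_counit] clinear_scale[OF clinear_counit]
        scaleC_complex_def)
qed

lemma counit_P: "counit (P u) = counit u"
  using counit_left_ideal[OF minus_P_in[of u]] by (simp add: clinear_diff[OF clinear_counit])

text \<open>In the contracted leg \<open>counit_P\<close> absorbs the projection, in the other leg
  it survives. Since \<open>P\<close> fixes 1 and 0, the normalisation of the twist is kept.\<close>

lemma counit_P2: "counit_left (P2 t) = P (counit_left t)" "counit_right (P2 t) = P (counit_right t)"
proof -
  have bil: "cbilinear (\<lambda>a b :: 'g uea. counit a *\<^sub>C b)" "cbilinear (\<lambda>a b :: 'g uea. counit b *\<^sub>C a)"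
    by (rule cbilinearI; simp add: clinear_add[OF clinear_counit] clinear_scale[OF clinear_counit]
      scaleC_add_left scaleC_add_right scaleC_scaleC scaleC_complex_def mult.commute)+
  have lin: "clinear (counit_left :: 'g uea2 \<Rightarrow> _)" "clinear (counit_right :: 'g uea2 \<Rightarrow> _)"
    unfolding counit_left_def counit_right_def by (intro clinear_tensor_lift bil)+
  show "counit_left (P2 t) = P (counit_left t)"
    by (rule clinear_eq_on_pure[OF clinear_compose[OF lin(1) clinear_P2] clinear_compose[OF clinear_P lin(1)]])
      (simp add: P2_pure counit_left_pure counit_P clinear_scale[OF clinear_P])
  show "counit_right (P2 t) = P (counit_right t)"
    by (rule clinear_eq_on_pure[OF clinear_compose[OF lin(2) clinear_P2] clinear_compose[OF clinear_P lin(2)]])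
      (simp add: P2_pure counit_right_pure counit_P clinear_scale[OF clinear_P])
qed

section \<open>Identification of \<open>P2\<close> with the projection in the definition of
  \<open>twist_projection\<close>\<close>

lemma P2_in: "P2 t \<in> tensor_sub (uea_sub \<vv>) (uea_sub \<vv>)"
proof (rule clinear_image_tensor_subspace[OF _ clinear_P2])
  show "P2 (a \<otimes> b) \<in> tensor_sub (uea_sub \<vv>) (uea_sub \<vv>)" for a b
    unfolding P2_pure tensor_sub_def using P_in by (intro cvec.span_base) blast
qed (simp add: tensor_sub_def cvec.subspace_span)

lemma P2_id: "t \<in> tensor_sub (uea_sub \<vv>) (uea_sub \<vv>) \<Longrightarrow> P2 t = t"
  unfolding tensor_sub_def
proof (induction rule: cvec.span_induct_alt)
  case (step c s t)
  then have "P2 s = s"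
    by (auto simp: P2_pure P_id)
  then show ?case
    using step.IH by (simp add: clinear_add[OF clinear_P2] clinear_scale[OF clinear_P2])
qed (simp add: clinear_0[OF clinear_P2])

definition proj_kernel :: "'g uea2 set" where
  "proj_kernel = {s + t |s t. s \<in> tensor_sub (uea_left_ideal \<hh>) UNIV \<and>
                              t \<in> tensor_sub UNIV (uea_left_ideal \<hh>)}"

lemma P2_zero:
  assumes "t \<in> proj_kernel"
  shows "P2 t = 0"
proof -
  have "P2 s = 0" if "s \<in> tensor_sub (uea_left_ideal \<hh>) UNIV" for s
    using that unfolding tensor_sub_def
  proof (induction rule: cvec.span_induct_alt)
    case (step c s t)
    then have "P2 s = 0"
      by (auto simp: P2_pure P_zero clinear_0[OF clinear_pure_left])
    then show ?case
      using step.IH by (simp add: clinear_add[OF clinear_P2] clinear_scale[OF clinear_P2] cvec.scale_zero_right)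
  qed (simp add: clinear_0[OF clinear_P2])
  moreover have "P2 s = 0" if "s \<in> tensor_sub UNIV (uea_left_ideal \<hh>)" for s
    using that unfolding tensor_sub_def
  proof (induction rule: cvec.span_induct_alt)
    case (step c s t)
    then have "P2 s = 0"
      by (auto simp: P2_pure P_zero clinear_0[OF clinear_pure_right])
    then show ?case
      using step.IH by (simp add: clinear_add[OF clinear_P2] clinear_scale[OF clinear_P2] cvec.scale_zero_right)
  qed (simp add: clinear_0[OF clinear_P2])
  ultimately show ?thesis
    using assms by (auto simp: proj_kernel_def clinear_add[OF clinear_P2])
qed

text \<open>On a pure tensor, replace one leg at a time by its projection: the first change lies in
  one summand of the kernel, the second in the other.\<close>

lemma minus_P2_in: "t - P2 t \<in> proj_kernel"
proof (rule clinear_image_tensor_subspace[where F = "\<lambda>t. t - P2 t"])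
  show "cvec.subspace proj_kernel"
    unfolding proj_kernel_def
    by (rule cvec.subspace_sums) (simp_all add: tensor_sub_def cvec.subspace_span)
  show "clinear (\<lambda>t. t - P2 t)"
    by (intro clinear_intros clinear_P2)
  fix a b :: "'g uea"
  have "(a - P a) \<otimes> b \<in> tensor_sub (uea_left_ideal \<hh>) UNIV"
    "P a \<otimes> (b - P b) \<in> tensor_sub UNIV (uea_left_ideal \<hh>)"
    unfolding tensor_sub_def using minus_P_in by (blast intro: cvec.span_base)+
  moreover have "a \<otimes> b - P2 (a \<otimes> b) = (a - P a) \<otimes> b + P a \<otimes> (b - P b)"
    by (simp add: P2_pure clinear_diff[OF clinear_pure_left] clinear_diff[OF clinear_pure_right])
  ultimately show "a \<otimes> b - P2 (a \<otimes> b) \<in> proj_kernel"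
    unfolding proj_kernel_def by blast
qed

text \<open>Coefficientwise, \<open>P2_in\<close> and \<open>minus_P2_in\<close> give existence.
  Uniqueness holds because \<open>P2\<close> fixes the first subspace and kills the second.\<close>

lemma twist_projection_eq: "twist_projection \<hh> \<vv> F = fps_apply P2 F"
  unfolding twist_projection_def proj_along_def proj_kernel_def[symmetric]
proof (rule the_equality)
  show "fps_apply P2 F \<in> fps_over (tensor_sub (uea_sub \<vv>) (uea_sub \<vv>)) \<and>
      F - fps_apply P2 F \<in> fps_over proj_kernel"
    by (simp add: fps_over_def fps_nth_apply P2_in minus_P2_in)
next
  fix K
  assume "K \<in> fps_over (tensor_sub (uea_sub \<vv>) (uea_sub \<vv>)) \<and> F - K \<in> fps_over proj_kernel"
  then have "P2 (fps_nth K n) = fps_nth K n" "P2 (fps_nth F n - fps_nth K n) = 0" for n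
    by (auto simp: fps_over_def P2_id P2_zero)
  then show "K = fps_apply P2 F"
    by (intro fps_ext) (simp add: fps_nth_apply clinear_diff[OF clinear_P2])
qed

section \<open>From the dynamical equation to the twist equation\<close>

lemma quantum_twist_projection:
  assumes "B \<subseteq> \<hh>" and inv: "J l \<in> fps_over (invariants \<hh>)"
    and eq: "fps_apply leg_12_3 (J l) * dynamical_shift B J l
          = fps_apply leg_1_23 (J l) * fps_apply leg_23 (J l)"
    and counit: "fps_apply counit_left (J l) = 1" "fps_apply counit_right (J l) = 1"
  shows "quantum_twist (uea_sub \<vv>) (twist_projection \<hh> \<vv> (J l))"
  unfolding quantum_twist_def twist_projection_eq
proof (intro conjI)
  let ?K = "fps_apply P2 (J l)"
  show "?K \<in> fps_over (tensor_sub (uea_sub \<vv>) (uea_sub \<vv>))"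
    by (simp add: fps_over_def fps_nth_apply P2_in)
  have inv: "fps_nth (J l) n \<in> invariants \<hh>" for n
    using inv by (simp add: fps_over_def)
  show "fps_apply leg_12_3 ?K * fps_apply leg_12 ?K = fps_apply leg_1_23 ?K * fps_apply leg_23 ?K"
  proof (rule fps_ext)
    fix n
    \<comment> \<open>\<open>P3\<close> is taken through the Cauchy product term by term; in each
      term the shift may be replaced by \<open>leg_12\<close> of the same coefficient of
      \<open>J l\<close>, after which \<open>P3_leg_12_3\<close> applies.\<close>
    have "fps_nth (fps_apply leg_12_3 ?K * fps_apply leg_12 ?K) n
        = P3 (fps_nth (fps_apply leg_12_3 (J l) * dynamical_shift B J l) n)"
      by (simp add: fps_mult_nth fps_nth_apply clinear_sum[OF clinear_P3] P3_dynamical_shift[OF assms(1)]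
          P3_leg_12_3[OF inv])
    also have "\<dots> = fps_nth (fps_apply leg_1_23 ?K * fps_apply leg_23 ?K) n"
      unfolding eq by (simp add: fps_mult_nth fps_nth_apply clinear_sum[OF clinear_P3] P3_leg_1_23[OF inv])
    finally show "fps_nth (fps_apply leg_12_3 ?K * fps_apply leg_12 ?K) n
        = fps_nth (fps_apply leg_1_23 ?K * fps_apply leg_23 ?K) n" .
  qed
  have "counit_left (fps_nth (J l) n) = fps_nth 1 n" "counit_right (fps_nth (J l) n) = fps_nth 1 n" for n
    using counit by (simp_all flip: fps_nth_apply)
  then show "fps_apply counit_left ?K = 1" "fps_apply counit_right ?K = 1"
    by (auto intro!: fps_ext simp: fps_nth_apply counit_P2 P_1 clinear_0[OF clinear_P])
qed

end

theorem theorem36: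
  fixes \<hh> \<vv> B :: "'g::lie_algebra set"
    and J :: "('g \<Rightarrow> complex) \<Rightarrow> ('g uea, 'g uea) tensor fps"
  assumes "finite_dimensional (UNIV :: 'g set)"
    and "abelian_lie_subalgebra \<hh>"
    and "\<not> cvec.dependent B" and "cvec.span B = \<hh>"
    and "quantum_dynamical_twist \<hh> B J"
    and "lie_subalgebra \<vv>"
    and "direct_sum \<hh> \<vv> UNIV"
  shows "direct_sum (uea_sub \<vv>) (uea_left_ideal \<hh>) UNIV \<and>
         (\<forall>l\<in>Dom \<hh> J. quantum_twist (uea_sub \<vv>) (twist_projection \<hh> \<vv> (J l)))"
proof -
  interpret lie_complement \<hh> \<vv>
    using assms by unfold_locales (auto simp: abelian_lie_subalgebra_def)
  have "B \<subseteq> \<hh>"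
    using assms(4) cvec.span_superset by blast
  then have "quantum_twist (uea_sub \<vv>) (twist_projection \<hh> \<vv> (J l))" if "l \<in> Dom \<hh> J" for l
    using assms(5) that unfolding quantum_dynamical_twist_def
    by (intro quantum_twist_projection) blast+
  then show ?thesis
    using direct_sum_uea by blast
qed

end
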